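(* Let $X$, $Y$ be Banach spaces over $\mathbb{K}$ and let $C\subset S_{Y^*}$ be such that $B_{Y^*}=\overline{\operatorname{conv}}^{w^*}(C)$. (a) Given $P,Q\in\mathcal{P}(X,Y)$, we have that $P\perp_B Q$ if and only if $$0\in\operatorname{conv}\{\lim y_n^*(Q(x_n))\colon x_n\in B_X,\ y_n^*\in C\ \forall n\in\mathbb{N},\ \lim y_n^*(P(x_n))=\|P\|\}.$$ (b) $P\in\mathcal{P}(X,Y)$ is a smooth point of $\mathcal{P}(X,Y)$ if and only if the set $$\{\lim y_n^*(Q(x_n))\colon x_n\in B_X,\ y_n^*\in C\ \forall n\in\mathbb{N},\ \lim y_n^*(P(x_n))=\|P\|\}$$ is a singleton for every $Q\in\mathcal{P}(X,Y)$.
   Context: $\mathbb{K}$ is $\mathbb{R}$ or $\mathbb{C}$. A (continuous) $N$-homogeneous polynomial from $X$ to $Y$ is a map $P\colon X\to Y$ of the form $P(x)=T(x,\ldots,x)$ for a continuous symmetric $N$-linear map $T\colon X\times\cdots\times X\to Y$ ($0$-homogeneous polynomials being the constants). A polynomial is a finite sum of homogeneous polynomials; $\mathcal{P}(X,Y)$ is the space of all of them, regarded (by restriction to $B_X$) as a subspace of the bounded functions from $B_X$ to $Y$, with norm $\|P\|=\sup_{x\in B_X}\|P(x)\|$. $B_{Y^*}$, $S_{Y^*}$ are the closed unit ball and unit sphere of $Y^*$; $\overline{\operatorname{conv}}^{w^*}$ is the weak-star closed convex hull, $\operatorname{conv}$ the convex hull. $x\perp_B y$ (Birkhoff-James orthogonality)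 means $\|x+\lambda y\|\geq\|x\|$ for all $\lambda\in\mathbb{K}$. A point $z$ of a normed space $Z$ is smooth if $\{\phi\in Z^*\colon\|\phi\|=1,\ \phi(z)=\|z\|\}$ is a singleton. Writing $\lim a_n$ for a bounded scalar sequence means that the sequence is required to be convergent. *)

theory Defs
  imports "HOL-Analysis.Analysis" "HOL-Library.Function_Algebras" "HOL-Combinatorics.Permutations"
begin

text \<open>Scalar fields: normed fields that are, up to isometric isomorphism, \<open>\<real>\<close> or \<open>\<complex>\<close>.\<close>

class real_or_complex = real_normed_field +
  assumes real_or_complex_embedding:
    "\<exists>\<phi> :: 'a \<Rightarrow> complex.
       (\<forall>x y. \<phi> (x + y) = \<phi> x + \<phi> y) \<and> (\<forall>x y. \<phi> (x * y) = \<phi> x * \<phi> y) \<and>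
       (\<forall>r x. \<phi> (r *\<^sub>R x) = r *\<^sub>R \<phi> x) \<and> (\<forall>x. norm (\<phi> x) = norm x) \<and>
       (range \<phi> = \<real> \<or> range \<phi> = UNIV)"

instance real :: real_or_complex
proof
  have "range complex_of_real = \<real>"
    by (simp add: Reals_def)
  then show "\<exists>\<phi> :: real \<Rightarrow> complex.
       (\<forall>x y. \<phi> (x + y) = \<phi> x + \<phi> y) \<and> (\<forall>x y. \<phi> (x * y) = \<phi> x * \<phi> y) \<and>
       (\<forall>r x. \<phi> (r *\<^sub>R x) = r *\<^sub>R \<phi> x) \<and> (\<forall>x. norm (\<phi> x) = norm x) \<and>
       (range \<phi> = \<real> \<or> range \<phi> = UNIV)"
    by (intro exI[of _ complex_of_real]) (simp add: scaleR_conv_of_real)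
qed

instance complex :: real_or_complex
  by standard (rule exI[of _ "\<lambda>z. z"], simp)

text \<open>The underlying real Banach space structure is that of the type; \<open>scl\<close> extends it to the
  scalar field.\<close>

locale banach_over = vector_space scl
  for scl :: "'k::real_or_complex \<Rightarrow> 'v::banach \<Rightarrow> 'v" +
  assumes scale_of_real: "scl (of_real r) v = r *\<^sub>R v"
    and norm_scale: "norm (scl c v) = norm c * norm v"

text \<open>Elements of \<open>'v \<Rightarrow>\<^sub>L 'k\<close> are only real-linear; the condition selects those linear over \<open>'k\<close>.
  Their norm as bounded linear functions is the dual norm.\<close>

definition dual :: "('k::real_or_complex \<Rightarrow> 'v::banach \<Rightarrow> 'v) \<Rightarrow> ('v \<Rightarrow>\<^sub>L 'k) set" where
  "dual scl = {f. \<forall>c v. blinfun_apply f (scl c v) = c * blinfun_apply f v}"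

text \<open>The topology of pointwise convergence on the dual space.\<close>

definition weak_star_topology ::
    "('k::real_or_complex \<Rightarrow> 'v::banach \<Rightarrow> 'v) \<Rightarrow> ('v \<Rightarrow>\<^sub>L 'k) topology" where
  "weak_star_topology scl = pullback_topology (dual scl) blinfun_apply euclidean"

text \<open>The product \<open>X \<times> \<dots> \<times> X\<close> of \<open>N\<close> factors is the set \<open>{..<N} \<rightarrow>\<^sub>E UNIV\<close>,
  the carrier of the product topology below; values of \<open>T\<close> elsewhere are irrelevant.\<close>

definition continuous_symmetric_multilinear ::
    "('k::real_or_complex \<Rightarrow> 'v::banach \<Rightarrow> 'v) \<Rightarrow> ('k \<Rightarrow> 'w::banach \<Rightarrow> 'w) \<Rightarrow>
     nat \<Rightarrow> ((nat \<Rightarrow> 'v) \<Rightarrow> 'w) \<Rightarrow> bool" where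
  "continuous_symmetric_multilinear scaleX scaleY N T \<longleftrightarrow>
     continuous_map (product_topology (\<lambda>_. euclidean) {..<N}) euclidean T \<and>
     (\<forall>v \<in> {..<N} \<rightarrow>\<^sub>E UNIV. \<forall>i<N. Vector_Spaces.linear scaleX scaleY (\<lambda>x. T (v(i := x)))) \<and>
     (\<forall>v \<in> {..<N} \<rightarrow>\<^sub>E UNIV. \<forall>\<sigma>. \<sigma> permutes {..<N} \<longrightarrow> T (v \<circ> \<sigma>) = T v)"

definition homogeneous_polynomial ::
    "('k::real_or_complex \<Rightarrow> 'v::banach \<Rightarrow> 'v) \<Rightarrow> ('k \<Rightarrow> 'w::banach \<Rightarrow> 'w) \<Rightarrow>
     nat \<Rightarrow> ('v \<Rightarrow> 'w) \<Rightarrow> bool" where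
  "homogeneous_polynomial scaleX scaleY N P \<longleftrightarrow>
     (\<exists>T. continuous_symmetric_multilinear scaleX scaleY N T \<and>
          (\<forall>x. P x = T (\<lambda>i\<in>{..<N}. x)))"

definition polynomials ::
    "('k::real_or_complex \<Rightarrow> 'v::banach \<Rightarrow> 'v) \<Rightarrow> ('k \<Rightarrow> 'w::banach \<Rightarrow> 'w) \<Rightarrow> ('v \<Rightarrow> 'w) set" where
  "polynomials scaleX scaleY =
     {P. \<exists>(m::nat) d p. (\<forall>k<m. homogeneous_polynomial scaleX scaleY (d k) (p k)) \<and>
                      P = (\<lambda>x. \<Sum>k<m. p k x)}"

text \<open>Meaningful for functions bounded on the unit ball, such as continuous polynomials.\<close>

definition ball_norm :: "('v::real_normed_vector \<Rightarrow> 'w::real_normed_vector) \<Rightarrow> real" where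
  "ball_norm P = (SUP x\<in>cball 0 1. norm (P x))"

definition pointwise_scale :: "('k \<Rightarrow> 'w \<Rightarrow> 'w) \<Rightarrow> 'k \<Rightarrow> ('v \<Rightarrow> 'w) \<Rightarrow> 'v \<Rightarrow> 'w" where
  "pointwise_scale scl c P = (\<lambda>x. scl c (P x))"

text \<open>The space of polynomials has no type of its own, so the notions for a general normed space
  are stated for a linear subspace \<open>Z\<close> of an ambient type with scalar multiplication \<open>scl\<close> and
  a norm \<open>nrm\<close> on \<open>Z\<close>. Addition of functions is pointwise.
  Functionals on \<open>Z\<close> are extensional, so that they are equal when they agree on \<open>Z\<close>.\<close>

definition birkhoff_orthogonal ::
    "('k \<Rightarrow> 'z \<Rightarrow> 'z) \<Rightarrow> ('z \<Rightarrow> real) \<Rightarrow> 'z \<Rightarrow> 'z::ab_group_add \<Rightarrow> bool" where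
  "birkhoff_orthogonal scl nrm x y \<longleftrightarrow> (\<forall>c. nrm (x + scl c y) \<ge> nrm x)"

definition functionals_on ::
    "('k::real_or_complex \<Rightarrow> 'z \<Rightarrow> 'z) \<Rightarrow> 'z::ab_group_add set \<Rightarrow> ('z \<Rightarrow> real) \<Rightarrow> ('z \<Rightarrow> 'k) set" where
  "functionals_on scl Z nrm =
     {\<phi> \<in> extensional Z.
        (\<forall>x\<in>Z. \<forall>y\<in>Z. \<phi> (x + y) = \<phi> x + \<phi> y) \<and>
        (\<forall>c. \<forall>x\<in>Z. \<phi> (scl c x) = c * \<phi> x) \<and>
        (\<exists>B. \<forall>x\<in>Z. norm (\<phi> x) \<le> B * nrm x)}"

definition functional_norm :: "'z set \<Rightarrow> ('z \<Rightarrow> real) \<Rightarrow> ('z \<Rightarrow> 'k::real_or_complex) \<Rightarrow> real" where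
  "functional_norm Z nrm \<phi> = (SUP z\<in>{z\<in>Z. nrm z \<le> 1}. norm (\<phi> z))"

definition smooth_point ::
    "('k::real_or_complex \<Rightarrow> 'z \<Rightarrow> 'z) \<Rightarrow> 'z::ab_group_add set \<Rightarrow> ('z \<Rightarrow> real) \<Rightarrow> 'z \<Rightarrow> bool" where
  "smooth_point scl Z nrm z \<longleftrightarrow>
     is_singleton {\<phi> \<in> functionals_on scl Z nrm.
                     functional_norm Z nrm \<phi> = 1 \<and> \<phi> z = of_real (nrm z)}"

definition norming_limits ::
    "('w \<Rightarrow>\<^sub>L 'k::real_or_complex) set \<Rightarrow> ('v::banach \<Rightarrow> 'w::banach) \<Rightarrow> ('v \<Rightarrow> 'w) \<Rightarrow> 'k set" where
  "norming_limits C P Q =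
     {l. \<exists>x y. (\<forall>n::nat. x n \<in> cball 0 1 \<and> y n \<in> C) \<and>
               (\<lambda>n. blinfun_apply (y n) (P (x n))) \<longlonglongrightarrow> of_real (ball_norm P) \<and>
               (\<lambda>n. blinfun_apply (y n) (Q (x n))) \<longlonglongrightarrow> l}"

end

theory Submission imports Defs
begin

text \<open>
  The only property of polynomials that matters is that they form a linear space of functions bounded
  on the unit ball which contains the constants. By Hahn-Banach, \<open>\<parallel>y\<parallel>\<close> is the supremum over \<open>C\<close> of the
  real parts of \<open>y\<^sup>*(y)\<close>, so every bounded \<open>R\<close> is almost normed in real part by some pair \<open>(x, y\<^sup>*)\<close>.

  (a) A limit \<open>l\<close> gives \<open>\<parallel>P + a Q\<parallel> \<ge> \<bar>\<parallel>P\<parallel> + a l\<bar>\<close>, and this passes to convex combinations. Conversely,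
  the set of limits is a compact set of scalars, so if its hull misses \<open>0\<close> it can be strictly
  separated from \<open>0\<close>, which is incompatible with pairs that almost norm \<open>P + (a / n) Q\<close>.

  (b) Every limit at \<open>Q\<close> is the value at \<open>Q\<close> of a support functional of \<open>P\<close>, namely of a cluster point of
  the evaluations \<open>R \<mapsto> y\<^sub>n\<^sup>*(R(x\<^sub>n))\<close>. Conversely, if all limits are unique they define a
  support functional \<open>\<phi>\<close>; any other one \<open>\<psi>\<close> vanishes at \<open>R = Q - (\<psi>(Q) / \<parallel>P\<parallel>) P\<close>, hence \<open>P\<close> is
  orthogonal to \<open>R\<close> and part (a) yields \<open>\<phi>(R) = 0\<close>, that is \<open>\<phi>(Q) = \<psi>(Q)\<close>.
\<close>

section \<open>Scalars\<close>

text \<open>The class only asserts that an embedding exists. Fixing one by choice lets both fields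
  be treated at once inside the complex numbers.\<close>

definition scalar_embedding :: "'k::real_or_complex \<Rightarrow> complex" where
  "scalar_embedding = (SOME \<phi>.
       (\<forall>x y. \<phi> (x + y) = \<phi> x + \<phi> y) \<and> (\<forall>x y. \<phi> (x * y) = \<phi> x * \<phi> y) \<and>
       (\<forall>r x. \<phi> (r *\<^sub>R x) = r *\<^sub>R \<phi> x) \<and> (\<forall>x. norm (\<phi> x) = norm x) \<and>
       (range \<phi> = \<real> \<or> range \<phi> = UNIV))"

lemma
  fixes x y :: "'k::real_or_complex"
  shows scalar_embedding_add: "scalar_embedding (x + y) = scalar_embedding x + scalar_embedding y"
    and scalar_embedding_mult: "scalar_embedding (x * y) = scalar_embedding x * scalar_embedding y"
    and scalar_embedding_scaleR: "scalar_embedding (r *\<^sub>R x) = r *\<^sub>R scalar_embedding x"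
    and norm_scalar_embedding: "norm (scalar_embedding x) = norm x"
    and range_scalar_embedding: "range (scalar_embedding :: 'k \<Rightarrow> complex) = \<real> \<or>
           range (scalar_embedding :: 'k \<Rightarrow> complex) = UNIV"
  using someI_ex[OF real_or_complex_embedding[where 'a='k], folded scalar_embedding_def]
  by blast+

lemma linear_scalar_embedding: "linear scalar_embedding"
  by (rule linearI) (simp_all add: scalar_embedding_add scalar_embedding_scaleR)

lemma scalar_embedding_diff: "scalar_embedding (x - y) = scalar_embedding x - scalar_embedding y"
  by (rule linear_diff[OF linear_scalar_embedding])

lemma dist_scalar_embedding: "dist (scalar_embedding x) (scalar_embedding y) = dist x y"
  by (simp add: dist_norm norm_scalar_embedding flip: scalar_embedding_diff)

lemma tendsto_scalar_embedding_iff: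
  "((\<lambda>n. scalar_embedding (f n)) \<longlongrightarrow> scalar_embedding l) F \<longleftrightarrow> (f \<longlongrightarrow> l) F"
  unfolding tendsto_dist_iff[of _ "scalar_embedding l"] tendsto_dist_iff[of f l] dist_scalar_embedding ..

lemma inj_scalar_embedding: "inj scalar_embedding"
  by (rule injI) (metis dist_scalar_embedding dist_eq_0_iff)

lemma bounded_linear_scalar_embedding: "bounded_linear scalar_embedding"
  by (intro linear_scalar_embedding bounded_linear.intro bounded_linear_axioms.intro exI[of _ 1])
     (simp add: norm_scalar_embedding)

text \<open>The image of \<open>1\<close> is a nonzero idempotent, hence \<open>1\<close>; real
  homogeneity does the rest.\<close>

lemma scalar_embedding_of_real: "scalar_embedding (of_real r :: 'k::real_or_complex) = of_real r"
proof -
  let ?e = "scalar_embedding (1::'k)"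
  have "?e * ?e = ?e" by (metis mult_1 scalar_embedding_mult)
  moreover have "?e \<noteq> 0" by (metis norm_scalar_embedding norm_one norm_zero zero_neq_one)
  ultimately have "?e = 1" by simp
  then show ?thesis
    by (simp add: of_real_def scalar_embedding_scaleR)
qed

text \<open>A bounded sequence is sent to the complex plane, where a subsequence converges. The
  range of the embedding is closed, so the limit comes from a scalar. This supplies the convergent
  subsequences and compact sets of scalars used below.\<close>

instance real_or_complex \<subseteq> heine_borel
proof
  fix f :: "nat \<Rightarrow> 'a"
  assume "bounded (range f)"
  then have "bounded (range (\<lambda>n. scalar_embedding (f n)))"
    by (simp add: bounded_iff norm_scalar_embedding)
  from bounded_imp_convergent_subsequence[OF this]
  obtain z r where r: "strict_mono r" and lim: "(\<lambda>n. scalar_embedding (f (r n))) \<longlonglongrightarrow> z"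
    unfolding o_def by (elim exE conjE)
  have closed: "closed (range (scalar_embedding :: 'a \<Rightarrow> complex))"
    using range_scalar_embedding[where 'k='a] by (elim disjE) (simp_all add: closed_complex_Reals)
  have "z \<in> range (scalar_embedding :: 'a \<Rightarrow> complex)"
    by (rule closed_sequentially[OF closed _ lim]) simp
  then obtain l :: 'a where "z = scalar_embedding l"
    by (rule rangeE)
  with lim have "(f \<circ> r) \<longlonglongrightarrow> l"
    by (simp only: tendsto_scalar_embedding_iff o_def)
  with r show "\<exists>l r. strict_mono r \<and> (f \<circ> r) \<longlonglongrightarrow> l"
    by (intro exI conjI)
qed

text \<open>A real part available in both fields, so that scalars can be compared by order.\<close>

definition scalar_re :: "'k::real_or_complex \<Rightarrow> real" where
  "scalar_re x = Re (scalar_embedding x)"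

lemma bounded_linear_scalar_re: "bounded_linear scalar_re"
  unfolding scalar_re_def
  by (rule bounded_linear_compose[OF bounded_linear_Re bounded_linear_scalar_embedding])

lemmas linear_scalar_re = bounded_linear.linear[OF bounded_linear_scalar_re]

lemma scalar_re_of_real [simp]: "scalar_re (of_real r) = r"
  by (simp add: scalar_re_def scalar_embedding_of_real)

lemma scalar_re_le_norm: "scalar_re x \<le> norm x"
  unfolding scalar_re_def by (metis complex_Re_le_cmod norm_scalar_embedding)

lemma scalar_re_of_real_mult: "scalar_re (of_real r * x) = r * scalar_re x"
  using linear_cmul[OF linear_scalar_re, of r x] by (simp add: scaleR_conv_of_real)

text \<open>In the disc of radius \<open>b\<close> only the point \<open>b\<close> has real part
  \<open>b\<close>; quantitatively, the squared imaginary part is at most \<open>b\<^sup>2\<close>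
  minus the squared real part. Hence it is enough to control real parts when a sequence is to be
  norming.\<close>

lemma tendsto_norm_bound_if_scalar_re:
  fixes z :: "nat \<Rightarrow> 'k::real_or_complex"
  assumes "\<And>n. norm (z n) \<le> b" and "(\<lambda>n. scalar_re (z n)) \<longlonglongrightarrow> b"
  shows "z \<longlonglongrightarrow> of_real b"
proof -
  define w where "w n = scalar_embedding (z n)" for n
  have re: "(\<lambda>n. Re (w n)) \<longlonglongrightarrow> b"
    using assms(2) by (simp add: w_def scalar_re_def)
  have n: "norm (w n) \<le> b" for n
    using assms(1) by (simp add: w_def norm_scalar_embedding)
  have "norm ((Im (w n))\<^sup>2) \<le> b\<^sup>2 - (Re (w n))\<^sup>2" for n
    using power_mono[OF n[of n], of 2] by (simp add: cmod_power2)
  moreover have "(\<lambda>n. b\<^sup>2 - (Re (w n))\<^sup>2) \<longlonglongrightarrow> 0"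
    using tendsto_diff[OF tendsto_const[of "b\<^sup>2"] tendsto_power[OF re, of 2]] by simp
  ultimately have "(\<lambda>n. (Im (w n))\<^sup>2) \<longlonglongrightarrow> 0"
    by (rule Lim_null_comparison[OF always_eventually[OF allI]])
  then have "(\<lambda>n. \<bar>Im (w n)\<bar>) \<longlonglongrightarrow> 0"
    using tendsto_real_sqrt[of "\<lambda>n. (Im (w n))\<^sup>2" 0] by simp
  then have "(\<lambda>n. Im (w n)) \<longlonglongrightarrow> 0"
    by (simp only: tendsto_rabs_zero_iff)
  with re have "(\<lambda>n. w n) \<longlonglongrightarrow> of_real b"
    by (subst tendsto_complex_iff) simp
  then have "(\<lambda>n. scalar_embedding (z n)) \<longlonglongrightarrow> scalar_embedding (of_real b :: 'k)"
    by (simp only: w_def scalar_embedding_of_real)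
  then show ?thesis
    by (simp only: tendsto_scalar_embedding_iff)
qed

lemma ex_unit_mult_eq_norm:
  fixes z :: "'k::real_or_complex"
  obtains c where "norm c = 1" "c * z = of_real (norm z)"
proof (cases "z = 0")
  case False
  show ?thesis
    by (rule that[of "of_real (norm z) / z"]) (use False in \<open>simp_all add: norm_divide\<close>)
qed (use that[of 1] in simp)

text \<open>The hull of a compact set in the plane is compact, so a hyperplane separates it strictly
  from \<open>0\<close>. The real functional obtained must then be written as the real part of
  multiplication by a scalar of the field.\<close>

lemma scalar_separation:
  fixes L :: "'k::real_or_complex set"
  assumes "compact L" "0 \<notin> convex hull L"
  obtains c where "\<And>l. l \<in> L \<Longrightarrow> scalar_re (c * l) < 0"
proof -
  let ?e = "scalar_embedding :: 'k \<Rightarrow> complex"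
  have "compact (?e ` L)"
    using assms(1) bounded_linear_scalar_embedding
    by (intro compact_continuous_image linear_continuous_on)
  then have closed: "closed (convex hull (?e ` L))"
    by (intro compact_imp_closed compact_convex_hull)
  have "0 \<notin> ?e ` (convex hull L)"
  proof
    assume "0 \<in> ?e ` (convex hull L)"
    then obtain z where z: "z \<in> convex hull L" "?e z = 0" by auto
    then have "z = 0" by (metis norm_eq_zero norm_scalar_embedding)
    then show False using z(1) assms(2) by simp
  qed
  then have 0: "0 \<notin> convex hull (?e ` L)"
    unfolding convex_hull_linear_image[OF linear_scalar_embedding] .
  obtain a b where ab: "0 < b" "\<And>x. x \<in> convex hull (?e ` L) \<Longrightarrow> inner a x > b"
    using separating_hyperplane_closed_0[OF convex_convex_hull closed 0] by metis
  \<comment> \<open>Over the reals the imaginary parts vanish and \<open>Re a\<close> represents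
    \<open>inner a\<close>; over the complex numbers the conjugate of \<open>a\<close> does.\<close>
  have "\<exists>c. \<forall>l. Re (?e (c * l)) = inner a (?e l)"
    using range_scalar_embedding[where 'k='k]
  proof
    assume r: "range ?e = \<real>"
    then obtain c where "?e c = of_real (Re a)" by (metis Reals_of_real rangeE)
    moreover have "Im (?e l) = 0" for l
      using r complex_is_Real_iff by blast
    ultimately show ?thesis
      by (intro exI[of _ c]) (simp add: scalar_embedding_mult inner_complex_def)
  next
    assume "range ?e = UNIV"
    then obtain c where "?e c = cnj a" by (metis rangeE UNIV_I)
    then show ?thesis
      by (intro exI[of _ c]) (simp add: scalar_embedding_mult inner_complex_def)
  qed
  then obtain c where c: "\<And>l. Re (?e (c * l)) = inner a (?e l)" by blast
  show ?thesis
  proof (rule that[of "- c"])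
    fix l assume "l \<in> L"
    then have "?e l \<in> convex hull (?e ` L)" by (intro hull_inc imageI)
    then have "inner a (?e l) > 0" using ab(1) ab(2)[of "?e l"] by simp
    then show "scalar_re (- c * l) < 0"
      using c[of l] linear_neg[OF linear_scalar_re, of "c * l"] by (simp add: scalar_re_def)
  qed
qed

section \<open>The Hahn-Banach theorem\<close>

definition sublinear :: "('a::real_vector \<Rightarrow> real) \<Rightarrow> bool" where
  "sublinear q \<longleftrightarrow> (\<forall>x y. q (x + y) \<le> q x + q y) \<and> (\<forall>r>0. \<forall>x. q (r *\<^sub>R x) \<le> r * q x)"

lemma sublinear_add: "sublinear q \<Longrightarrow> q (x + y) \<le> q x + q y"
  by (simp add: sublinear_def)

lemma sublinear_scale:
  assumes "sublinear q" "r \<ge> 0"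
  shows "q (r *\<^sub>R x) = r * q x"
proof -
  have pos: "q (r *\<^sub>R x) = r * q x" if "r > 0" for r x
  proof (rule antisym)
    show "q (r *\<^sub>R x) \<le> r * q x"
      using assms(1) that by (simp add: sublinear_def)
    have "q (inverse r *\<^sub>R (r *\<^sub>R x)) \<le> inverse r * q (r *\<^sub>R x)"
      using assms(1) that unfolding sublinear_def by (meson positive_imp_inverse_positive)
    then show "r * q x \<le> q (r *\<^sub>R x)"
      using that by (simp add: field_simps)
  qed
  \<comment> \<open>For \<open>r = 0\<close> the value \<open>q 0\<close> must vanish, which follows
    from \<open>q 0 = 2 * q 0\<close>.\<close>
  show ?thesis
    using pos[of r x] pos[of 2 0] assms(2) by (cases "r = 0") auto
qed

lemma sublinear_ge_neg:
  assumes "sublinear q"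
  shows "- q (- x) \<le> q x"
  using sublinear_add[OF assms, of x "- x"] sublinear_scale[OF assms, of 0 0] by simp

text \<open>For sublinear \<open>q\<close> this is the largest sublinear functional below
  \<open>q\<close> whose value at \<open>- a\<close> is at most \<open>- q a\<close>.\<close>

definition sublinear_shift :: "('a::real_vector \<Rightarrow> real) \<Rightarrow> 'a \<Rightarrow> 'a \<Rightarrow> real" where
  "sublinear_shift q a x = (INF t\<in>{0..}. q (x + t *\<^sub>R a) - t * q a)"

text \<open>The parameter \<open>t = 0\<close> gives the bound by \<open>q\<close>, and
  \<open>t = 1\<close> the bound at \<open>- a\<close>. Subadditivity holds because parameters
  \<open>s\<close> for \<open>x\<close> and \<open>t\<close> for \<open>y\<close> allow
  \<open>s + t\<close> for \<open>x + y\<close>; homogeneity rescales the parameter.\<close>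

lemma sublinear_shift:
  assumes q: "sublinear q"
  shows sublinear_sublinear_shift: "sublinear (sublinear_shift q a)"
    and sublinear_shift_le: "sublinear_shift q a x \<le> q x"
    and sublinear_shift_neg_le: "sublinear_shift q a (- a) \<le> - q a"
proof -
  let ?s = "sublinear_shift q a"
  \<comment> \<open>This bound does not depend on \<open>t\<close>, so the infimum is one over a set
    bounded below.\<close>
  have lower: "- q (- x) \<le> q (x + t *\<^sub>R a) - t * q a" if "t \<ge> 0" for t x
    using sublinear_add[OF q, of "x + t *\<^sub>R a" "- x"] sublinear_scale[OF q that, of a] by simp
  have le: "?s x \<le> q (x + t *\<^sub>R a) - t * q a" if "t \<ge> 0" for t x
    unfolding sublinear_shift_def
    by (rule cINF_lower) (use that lower in \<open>auto intro!: bdd_belowI2\<close>)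
  have greatest: "b \<le> ?s x" if "\<And>t. t \<ge> 0 \<Longrightarrow> b \<le> q (x + t *\<^sub>R a) - t * q a" for b x
    unfolding sublinear_shift_def by (rule cINF_greatest) (use that in auto)
  show "?s x \<le> q x" for x
    using le[of 0 x] by simp
  show "?s (- a) \<le> - q a"
    using le[of 1 "- a"] sublinear_scale[OF q, of 0 0] by simp
  show "sublinear ?s"
    unfolding sublinear_def
  proof (intro conjI allI impI)
    fix x y
    have "?s (x + y) \<le> (q (x + s *\<^sub>R a) - s * q a) + (q (y + t *\<^sub>R a) - t * q a)"
      if "s \<ge> 0" "t \<ge> 0" for s t
      using le[of "s + t" "x + y"] that sublinear_add[OF q, of "x + s *\<^sub>R a" "y + t *\<^sub>R a"]
      by (simp add: algebra_simps)
    then have "?s (x + y) - (q (x + s *\<^sub>R a) - s * q a) \<le> ?s y" if "s \<ge> 0" for s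
      using that by (intro greatest) (smt (verit))
    then have "?s (x + y) - ?s y \<le> ?s x"
      by (intro greatest) (simp add: algebra_simps)
    then show "?s (x + y) \<le> ?s x + ?s y" by simp
  next
    fix r :: real and x assume r: "r > 0"
    have "?s (r *\<^sub>R x) / r \<le> q (x + t *\<^sub>R a) - t * q a" if "t \<ge> 0" for t
      using le[of "r * t" "r *\<^sub>R x"] that r sublinear_scale[OF q, of r "x + t *\<^sub>R a"]
      by (simp add: field_simps scaleR_add_right)
    then have "?s (r *\<^sub>R x) / r \<le> ?s x" by (rule greatest)
    then show "?s (r *\<^sub>R x) \<le> r * ?s x" using r by (simp add: field_simps)
  qed
qed

text \<open>A minimal sublinear functional equals all its shifts, hence is odd, hence linear.\<close>

theorem Hahn_Banach_sublinear:
  fixes p :: "'a::real_vector \<Rightarrow> real"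
  assumes p: "sublinear p"
  obtains f where "linear f" "\<And>x. f x \<le> p x"
proof -
  define A where "A = {q. sublinear q \<and> (\<forall>x. q x \<le> p x)}"
  \<comment> \<open>The order is reversed, so that Zorn's lemma produces a minimal element.\<close>
  let ?R = "\<lambda>f g. (\<forall>x::'a. (g x :: real) \<le> f x)"
  have "\<exists>m\<in>A. \<forall>a\<in>A. ?R m a \<longrightarrow> a = m"
  proof (rule predicate_Zorn)
    show "partial_order_on A (relation_of ?R A)"
      by (rule partial_order_on_relation_ofI) (auto intro: order_trans simp: fun_eq_iff antisym)
    fix D assume D: "D \<in> Chains (relation_of ?R A)"
    then have DA: "q \<in> A" if "q \<in> D" for q
      using that by (auto simp: Chains_def relation_of_def)
    have chain: "?R f g \<or> ?R g f" if "f \<in> D" "g \<in> D" for f g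
      using D that by (auto simp: Chains_def relation_of_def)
    show "\<exists>u\<in>A. \<forall>a\<in>D. ?R a u"
    proof (cases "D = {}")
      case True
      then show ?thesis using p by (auto simp: A_def)
    next
      case False
      \<comment> \<open>The pointwise infimum of the chain is finite, since each member is bounded
        below by \<open>- p (- x)\<close>.\<close>
      define u where "u x = (INF f\<in>D. f x)" for x
      have lower: "- p (- x) \<le> f x" if "f \<in> D" for f x
        using DA[OF that] sublinear_ge_neg[of f x]
        by (smt (verit) A_def mem_Collect_eq)
      have le: "u x \<le> f x" if "f \<in> D" for f x
        unfolding u_def by (rule cINF_lower) (use that lower in \<open>auto intro!: bdd_belowI2\<close>)
      have greatest: "b \<le> u x" if "\<And>f. f \<in> D \<Longrightarrow> b \<le> f x" for b x
        unfolding u_def by (rule cINF_greatest) (use that False in auto)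
      have "sublinear u"
        unfolding sublinear_def
      proof (intro conjI allI impI)
        fix x y
        have "u (x + y) \<le> f x + g y" if fg: "f \<in> D" "g \<in> D" for f g
        proof -
          \<comment> \<open>The smaller of \<open>f\<close> and \<open>g\<close> in the chain serves
            as \<open>h\<close>; one member for both points is what makes the infimum
            subadditive.\<close>
          obtain h where h: "h \<in> D" "h x \<le> f x" "h y \<le> g y"
            using chain[OF fg] fg by blast
          then have "u (x + y) \<le> h x + h y"
            using le[OF h(1), of "x + y"] DA[OF h(1)] sublinear_add[of h x y] by (simp add: A_def)
          then show ?thesis using h by simp
        qed
        then have "u (x + y) - f x \<le> u y" if "f \<in> D" for f
          using that by (intro greatest) (smt (verit))
        then have "u (x + y) - u y \<le> u x"
          by (intro greatest) (simp add: algebra_simps)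
        then show "u (x + y) \<le> u x + u y" by simp
      next
        fix r :: real and x assume r: "r > 0"
        have "u (r *\<^sub>R x) / r \<le> f x" if "f \<in> D" for f
          using le[OF that, of "r *\<^sub>R x"] DA[OF that] sublinear_scale[of f r x] r
          by (simp add: A_def field_simps)
        then have "u (r *\<^sub>R x) / r \<le> u x" by (rule greatest)
        then show "u (r *\<^sub>R x) \<le> r * u x" using r by (simp add: field_simps)
      qed
      moreover obtain f where "f \<in> D" using False by blast
      then have "u x \<le> p x" for x
        using le[of f x] DA[of f] by (force simp: A_def intro: order_trans)
      ultimately have "u \<in> A" by (simp add: A_def)
      then show ?thesis using le by blast
    qed
  qed
  then obtain m where m: "m \<in> A" "\<And>a. a \<in> A \<Longrightarrow> ?R m a \<Longrightarrow> a = m" by blast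
  have sm: "sublinear m" and mp: "\<And>x. m x \<le> p x" using m(1) by (auto simp: A_def)
  have odd: "m (- a) = - m a" for a
  proof -
    have "sublinear_shift m a \<in> A"
      using sublinear_sublinear_shift[OF sm] order_trans[OF sublinear_shift_le[OF sm] mp]
      by (simp add: A_def)
    then have "sublinear_shift m a = m"
      using m(2) sublinear_shift_le[OF sm] by blast
    then have "m (- a) \<le> - m a"
      using sublinear_shift_neg_le[OF sm, of a] by simp
    then show ?thesis using sublinear_ge_neg[OF sm, of "- a"] by simp
  qed
  have "linear m"
  proof (rule linearI)
    fix x y show "m (x + y) = m x + m y"
      using sublinear_add[OF sm, of x y] sublinear_add[OF sm, of "- x" "- y"]
        odd[of x] odd[of y] odd[of "x + y"] by simp
  next
    fix r x show "m (r *\<^sub>R x) = r *\<^sub>R m x"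
      using sublinear_scale[OF sm, of r x] sublinear_scale[OF sm, of "- r" x] odd[of "r *\<^sub>R x"]
      by (cases "r \<ge> 0") auto
  qed
  then show ?thesis using that mp by blast
qed

text \<open>A linear functional below the shift of the norm at \<open>y\<close> is at most
  \<open>- norm y\<close> at \<open>- y\<close>, which forces the value \<open>norm y\<close> at
  \<open>y\<close>.\<close>

corollary Hahn_Banach_norm:
  fixes y :: "'a::real_normed_vector"
  obtains f where "linear f" "\<And>x. f x \<le> norm x" "f y = norm y"
proof -
  have n: "sublinear (norm :: 'a \<Rightarrow> real)"
    by (simp add: sublinear_def norm_triangle_ineq)
  obtain f where f: "linear f" "\<And>x. f x \<le> sublinear_shift norm y x"
    using Hahn_Banach_sublinear[OF sublinear_sublinear_shift[OF n]] by blast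
  have le: "f x \<le> norm x" for x
    using f(2) sublinear_shift_le[OF n] order_trans by blast
  have "f (- y) \<le> - norm y"
    using f(2) sublinear_shift_neg_le[OF n] order_trans by blast
  then have "f y = norm y"
    using le[of y] linear_neg[OF f(1), of y] by simp
  then show ?thesis using that f(1) le by blast
qed

text \<open>A real functional \<open>u\<close> is the real part of the \<open>\<complex>\<close>-linear functional \<open>u v - i u (i v)\<close>.\<close>

theorem (in banach_over) Hahn_Banach_dual:
  obtains f where "f \<in> dual scl \<inter> cball 0 1" "blinfun_apply f y = of_real (norm y)"
proof -
  obtain u where u: "linear u" "\<And>v. u v \<le> norm v" "u y = norm y"
    using Hahn_Banach_norm by blast
  let ?e = "scalar_embedding :: 'k \<Rightarrow> complex"
  have scaleR_scl: "scl c (r *\<^sub>R v) = r *\<^sub>R scl c v" for c r v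
    by (simp add: scale_left_commute flip: scale_of_real)
  have "\<exists>f. (\<forall>v w. f (v + w) = f v + f w) \<and> (\<forall>c v. f (scl c v) = c * f v) \<and> (\<forall>v. scalar_re (f v) = u v)"
    using range_scalar_embedding[where 'k='k]
  proof
    assume R: "range ?e = \<real>"
    \<comment> \<open>All scalars are real here, so \<open>u\<close> itself, read as scalar-valued,
      is the functional.\<close>
    have *: "\<exists>r. c = of_real r" for c :: 'k
    proof -
      have "?e c \<in> \<real>" using R by blast
      then obtain r where "?e c = of_real r" by (auto elim: Reals_cases)
      then show ?thesis using inj_scalar_embedding
        by (metis injD scalar_embedding_of_real)
    qed
    have "of_real (u (scl c v)) = c * of_real (u v)" for c v
    proof -
      obtain r where "c = of_real r" using * by blast
      then show ?thesis by (simp add: scale_of_real linear_cmul[OF u(1)])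
    qed
    then show ?thesis
      by (intro exI[of _ "\<lambda>v. of_real (u v)"]) (simp add: linear_add[OF u(1)])
  next
    assume R: "range ?e = UNIV"
    \<comment> \<open>The field has no named imaginary unit; the preimage of the complex one takes
      its place.\<close>
    then obtain i where i: "?e i = \<i>" by (metis UNIV_I rangeE)
    have ii: "i * i = - 1"
    proof (rule injD[OF inj_scalar_embedding])
      show "?e (i * i) = ?e (- 1)"
        using scalar_embedding_of_real[of "-1", where 'k='k] by (simp add: scalar_embedding_mult i)
    qed
    have dec: "\<exists>a b. c = of_real a + of_real b * i" for c
    proof (intro exI, rule injD[OF inj_scalar_embedding])
      show "?e c = ?e (of_real (Re (?e c)) + of_real (Im (?e c)) * i)"
        by (simp add: scalar_embedding_add scalar_embedding_mult i scalar_embedding_of_real complex_eq_iff)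
    qed
    define f where "f v = of_real (u v) - i * of_real (u (scl i v))" for v
    have add: "f (v + w) = f v + f w" for v w
      by (simp add: f_def linear_add[OF u(1)] scale_right_distrib algebra_simps)
    have real: "f (scl (of_real r) v) = of_real r * f v" for r v
      by (simp add: f_def scale_of_real scaleR_scl linear_cmul[OF u(1)] algebra_simps)
    have "scl i (scl i v) = - v" for v
      by (simp add: ii)
    then have im: "f (scl i v) = i * f v" for v
      using ii by (simp add: f_def linear_neg[OF u(1)] algebra_simps flip: mult.assoc)
    have "f (scl c v) = c * f v" for c v
    proof -
      obtain a b where "c = of_real a + of_real b * i" using dec by blast
      then show ?thesis
        by (simp add: scale_left_distrib add real im algebra_simps flip: scale_scale)
    qed
    moreover have "scalar_re (f v) = u v" for v
      by (simp add: f_def scalar_re_def scalar_embedding_diff scalar_embedding_mult i scalar_embedding_of_real)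
    ultimately show ?thesis using add by blast
  qed
  then obtain f where f: "\<And>v w. f (v + w) = f v + f w" "\<And>c v. f (scl c v) = c * f v"
      "\<And>v. scalar_re (f v) = u v" by blast
  \<comment> \<open>Rotating \<open>v\<close> by a unimodular \<open>c\<close> makes the value of
    \<open>f\<close> real and nonnegative, where it equals \<open>u\<close> and is bounded by the
    norm.\<close>
  have norm: "norm (f v) \<le> norm v" for v
  proof -
    obtain c where c: "norm c = 1" "c * f v = of_real (norm (f v))"
      using ex_unit_mult_eq_norm by blast
    then have "norm (f v) = u (scl c v)"
      by (metis f(2,3) scalar_re_of_real)
    also have "\<dots> \<le> norm v" using u(2)[of "scl c v"] c(1) by (simp add: norm_scale)
    finally show ?thesis .
  qed
  have "bounded_linear f"
  proof (rule bounded_linear_intro[where K=1])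
    fix r v show "f (r *\<^sub>R v) = r *\<^sub>R f v"
      using f(2)[of "of_real r" v] by (simp add: scale_of_real scaleR_conv_of_real)
  qed (use f(1) norm in auto)
  then have B: "blinfun_apply (Blinfun f) = f" by (rule bounded_linear_Blinfun_apply)
  have "f y = of_real (norm y)"
  proof -
    \<comment> \<open>The value has real part \<open>norm y\<close> and modulus at most
      \<open>norm y\<close>; the convergence criterion for a constant sequence identifies
      it.\<close>
    have "(\<lambda>n. f y) \<longlonglongrightarrow> of_real (norm y)"
      using norm u(3) f(3) by (intro tendsto_norm_bound_if_scalar_re) auto
    then show ?thesis by (simp add: LIMSEQ_const_iff)
  qed
  moreover have "Blinfun f \<in> dual scl \<inter> cball 0 1"
    using f(2) norm by (auto simp: dual_def B intro!: norm_blinfun_bound)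
  ultimately show ?thesis using that B by metis
qed

section \<open>Polynomials\<close>

lemma homogeneous_polynomial_scaleR:
  assumes "banach_over scaleX" "banach_over scaleY" "homogeneous_polynomial scaleX scaleY N P"
  shows "P (r *\<^sub>R x) = r ^ N *\<^sub>R P x"
proof -
  interpret X: banach_over scaleX by fact
  interpret Y: banach_over scaleY by fact
  obtain T where T: "continuous_symmetric_multilinear scaleX scaleY N T"
    and P: "\<And>x. P x = T (\<lambda>i\<in>{..<N}. x)"
    using assms(3) unfolding homogeneous_polynomial_def by blast
  \<comment> \<open>The arguments of \<open>T\<close> are scaled one at a time: \<open>w k\<close>
    has the first \<open>k\<close> scaled, and each step costs one factor \<open>r\<close> by
    linearity in that variable.\<close>
  define w where "w k = (\<lambda>i\<in>{..<N}. if i < k then r *\<^sub>R x else x)" for k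
  have "T (w k) = r ^ k *\<^sub>R T (w 0)" if "k \<le> N" for k
    using that
  proof (induction k)
    case (Suc k)
    interpret L: Vector_Spaces.linear scaleX scaleY "\<lambda>z. T ((w k)(k := z))"
      using T Suc.prems unfolding continuous_symmetric_multilinear_def
      by (auto simp: w_def)
    have 1: "w (Suc k) = (w k)(k := r *\<^sub>R x)" and 2: "w k = (w k)(k := x)"
      using Suc.prems by (auto simp: w_def fun_eq_iff)
    have "T (w (Suc k)) = r *\<^sub>R T ((w k)(k := x))"
      unfolding 1 using L.scale[of "of_real r" x] by (simp add: X.scale_of_real Y.scale_of_real)
    then show ?case
      using Suc 2 by simp
  qed simp
  from this[of N] show ?thesis
    unfolding P by (simp add: w_def cong: restrict_cong)
qed

text \<open>Composition with the diagonal makes \<open>P\<close> continuous, hence bounded near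
  \<open>0\<close>; homogeneity carries this bound to the unit ball.\<close>

lemma bounded_homogeneous_polynomial:
  assumes "banach_over scaleX" "banach_over scaleY" "homogeneous_polynomial scaleX scaleY N P"
  shows "bounded (P ` cball 0 1)"
proof -
  obtain T where T: "continuous_symmetric_multilinear scaleX scaleY N T"
    and P: "\<And>x. P x = T (\<lambda>i\<in>{..<N}. x)"
    using assms(3) unfolding homogeneous_polynomial_def by blast
  have "continuous_map euclidean (product_topology (\<lambda>_. euclidean) {..<N}) (\<lambda>x. \<lambda>i\<in>{..<N}. x)"
    by (auto simp: continuous_map_componentwise)
  then have "continuous_map euclidean euclidean (T \<circ> (\<lambda>x. \<lambda>i\<in>{..<N}. x))"
    using T unfolding continuous_symmetric_multilinear_def by (blast intro: continuous_map_compose)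
  then have "continuous_on UNIV P"
    by (simp add: o_def P[abs_def])
  then obtain d where d: "d > 0" "\<And>x. dist x 0 < d \<Longrightarrow> dist (P x) (P 0) < 1"
    unfolding continuous_on_iff by (metis UNIV_I zero_less_one)
  have "norm (P x) \<le> (2 / d) ^ N * (1 + norm (P 0))" if "x \<in> cball 0 1" for x
  proof -
    \<comment> \<open>The factor \<open>d / 2\<close> moves the closed unit ball strictly inside the
      radius \<open>d\<close>.\<close>
    have "d * norm x < d * 2" using that d(1) by auto
    then have "dist (P ((d / 2) *\<^sub>R x)) (P 0) < 1"
      using d by (intro d(2)) simp
    then have le: "norm (P ((d / 2) *\<^sub>R x)) \<le> 1 + norm (P 0)"
      by (smt (verit) dist_norm norm_triangle_sub)
    have "norm (P x) = (2 / d) ^ N * norm (P ((d / 2) *\<^sub>R x))"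
      using d(1) homogeneous_polynomial_scaleR[OF assms, of "d / 2" x]
      by (simp add: power_divide)
    also have "\<dots> \<le> (2 / d) ^ N * (1 + norm (P 0))"
      using le d(1) by (intro mult_left_mono) auto
    finally show ?thesis .
  qed
  then show ?thesis unfolding bounded_iff by blast
qed

lemma bounded_polynomial:
  assumes "banach_over scaleX" "banach_over scaleY" "P \<in> polynomials scaleX scaleY"
  shows "bounded (P ` cball 0 1)"
proof -
  obtain m :: nat and d p where h: "\<And>k. k < m \<Longrightarrow> homogeneous_polynomial scaleX scaleY (d k) (p k)"
      and P: "P = (\<lambda>x. \<Sum>k<m. p k x)"
    using assms(3) unfolding polynomials_def by blast
  have "bounded ((\<lambda>x. \<Sum>k<n. p k x) ` cball 0 1)" if "n \<le> m" for n
    using that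
  proof (induction n)
    case 0
    then show ?case by (simp add: image_constant_conv)
  next
    case (Suc n)
    then show ?case
      using bounded_homogeneous_polynomial[OF assms(1,2) h]
      by (auto intro: bounded_plus_comp)
  qed
  then show ?thesis unfolding P by blast
qed

section \<open>Linear structure of the space of polynomials\<close>

lemma polynomials_const:
  "(\<lambda>_. y) \<in> polynomials scaleX scaleY"
proof -
  have "homogeneous_polynomial scaleX scaleY 0 (\<lambda>_. y)"
    unfolding homogeneous_polynomial_def continuous_symmetric_multilinear_def
    by (intro exI[of _ "\<lambda>_. y"]) auto
  then show ?thesis
    unfolding polynomials_def
    by (intro CollectI exI[of _ 1] exI[of _ "\<lambda>_. 0"] exI[of _ "\<lambda>_ _. y"]) auto
qed

lemma polynomials_add:
  assumes "P \<in> polynomials scaleX scaleY" "Q \<in> polynomials scaleX scaleY"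
  shows "P + Q \<in> polynomials scaleX scaleY"
proof -
  obtain m :: nat and d p where p: "\<And>k. k < m \<Longrightarrow> homogeneous_polynomial scaleX scaleY (d k) (p k)"
      and P: "P = (\<lambda>x. \<Sum>k<m. p k x)"
    using assms(1) unfolding polynomials_def by blast
  obtain n :: nat and e q where q: "\<And>k. k < n \<Longrightarrow> homogeneous_polynomial scaleX scaleY (e k) (q k)"
      and Q: "Q = (\<lambda>x. \<Sum>k<n. q k x)"
    using assms(2) unfolding polynomials_def by blast
  \<comment> \<open>The two families are concatenated, the second one with its indices shifted by
    \<open>m\<close>.\<close>
  let ?d = "\<lambda>k. if k < m then d k else e (k - m)"
  let ?p = "\<lambda>k. if k < m then p k else q (k - m)"
  have "P + Q = (\<lambda>x. \<Sum>k<m + n. ?p k x)"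
  proof
    fix x
    have "(\<Sum>k<m + n. ?p k x) = (\<Sum>k<m. ?p k x) + (\<Sum>k\<in>{m..<m + n}. ?p k x)"
      using sum.atLeastLessThan_concat[of 0 m "m + n" "\<lambda>k. ?p k x"] by (simp add: lessThan_atLeast0)
    also have "(\<Sum>k\<in>{m..<m + n}. ?p k x) = (\<Sum>k<n. ?p (k + m) x)"
      using sum.shift_bounds_nat_ivl[of "\<lambda>k. ?p k x" 0 m n]
      by (simp add: lessThan_atLeast0 add.commute)
    finally show "(P + Q) x = (\<Sum>k<m + n. ?p k x)"
      by (simp add: P Q)
  qed
  moreover have "homogeneous_polynomial scaleX scaleY (?d k) (?p k)" if "k < m + n" for k
    using that p q by simp
  ultimately show ?thesis
    unfolding polynomials_def by (intro CollectI exI[of _ "m + n"] exI[of _ ?d] exI[of _ ?p]) simp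
qed

lemma (in banach_over) continuous_on_scale: "continuous_on UNIV (scl c)"
proof -
  have "bounded_linear (scl c)"
  proof (rule bounded_linear_intro[where K="norm c"])
    show "scl c (r *\<^sub>R x) = r *\<^sub>R scl c x" for r x
      by (metis scale_left_commute scale_of_real)
  qed (auto simp: scale_right_distrib norm_scale)
  then show ?thesis by (rule linear_continuous_on)
qed

lemma homogeneous_polynomial_pointwise_scale:
  assumes "banach_over scaleY" "homogeneous_polynomial scaleX scaleY N P"
  shows "homogeneous_polynomial scaleX scaleY N (pointwise_scale scaleY c P)"
proof -
  interpret Y: banach_over scaleY by fact
  obtain T where T: "continuous_symmetric_multilinear scaleX scaleY N T"
    and P: "\<And>x. P x = T (\<lambda>i\<in>{..<N}. x)"
    using assms(2) unfolding homogeneous_polynomial_def by blast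
  have "continuous_map euclidean euclidean (scaleY c)"
    using Y.continuous_on_scale by simp
  then have "continuous_map (product_topology (\<lambda>_. euclidean) {..<N}) euclidean (\<lambda>v. scaleY c (T v))"
    using T continuous_map_compose[of _ euclidean T euclidean "scaleY c"]
    unfolding continuous_symmetric_multilinear_def o_def by blast
  moreover have "Vector_Spaces.linear scaleX scaleY (\<lambda>x. scaleY c (f x))"
    if "Vector_Spaces.linear scaleX scaleY f" for f
  proof -
    interpret vector_space_pair scaleX scaleY
      using that by (simp add: Vector_Spaces.linear_def vector_space_pair_def)
    show ?thesis using that by (rule linear_compose_scale_right)
  qed
  ultimately have "continuous_symmetric_multilinear scaleX scaleY N (\<lambda>v. scaleY c (T v))"
    using T unfolding continuous_symmetric_multilinear_def by simp
  then show ?thesis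
    unfolding homogeneous_polynomial_def by (auto simp: P pointwise_scale_def)
qed

lemma polynomials_pointwise_scale:
  assumes "banach_over scaleY" "P \<in> polynomials scaleX scaleY"
  shows "pointwise_scale scaleY c P \<in> polynomials scaleX scaleY"
proof -
  interpret Y: banach_over scaleY by fact
  obtain m :: nat and d p where p: "\<And>k. k < m \<Longrightarrow> homogeneous_polynomial scaleX scaleY (d k) (p k)"
      and P: "P = (\<lambda>x. \<Sum>k<m. p k x)"
    using assms(2) unfolding polynomials_def by blast
  have "pointwise_scale scaleY c P = (\<lambda>x. \<Sum>k<m. pointwise_scale scaleY c (p k) x)"
    by (simp add: P pointwise_scale_def Y.scale_sum_right)
  then show ?thesis
    unfolding polynomials_def
    by (intro CollectI exI[of _ m] exI[of _ d] exI[of _ "\<lambda>k. pointwise_scale scaleY c (p k)"])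
       (simp add: homogeneous_polynomial_pointwise_scale[OF assms(1) p])
qed

section \<open>Norming sequences\<close>

lemma norm_le_ball_norm:
  assumes "bounded (P ` cball 0 1)" "x \<in> cball 0 1"
  shows "norm (P x) \<le> ball_norm P"
proof -
  obtain b where "\<And>x. x \<in> cball 0 1 \<Longrightarrow> norm (P x) \<le> b"
    using assms(1) unfolding bounded_iff by blast
  then have "bdd_above ((\<lambda>x. norm (P x)) ` cball 0 1)"
    by (rule bdd_aboveI2)
  then show ?thesis
    unfolding ball_norm_def by (rule cSUP_upper[OF assms(2)])
qed

lemma ball_norm_nonneg:
  assumes "bounded (P ` cball 0 1)"
  shows "0 \<le> ball_norm P"
  using norm_ge_zero norm_le_ball_norm[OF assms, of 0] by (rule order_trans) simp

lemma ball_norm_le: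
  assumes "\<And>x. x \<in> cball 0 1 \<Longrightarrow> norm (P x) \<le> b"
  shows "ball_norm P \<le> b"
  unfolding ball_norm_def by (rule cSUP_least[OF _ assms]) simp_all

lemma less_ball_normE:
  assumes "b < ball_norm P"
  obtains x where "x \<in> cball 0 1" "b < norm (P x)"
proof -
  have "\<not> (\<forall>x\<in>cball 0 1. norm (P x) \<le> b)"
  proof
    assume "\<forall>x\<in>cball 0 1. norm (P x) \<le> b"
    then have "ball_norm P \<le> b" by (intro ball_norm_le) (rule bspec)
    then show False using assms by simp
  qed
  then show ?thesis using that unfolding not_le[symmetric] by blast
qed

section \<open>Sets of functionals whose weak-star closed convex hull is the dual ball\<close>

locale norming_set = banach_over scl
  for scl :: "'k::real_or_complex \<Rightarrow> 'y::banach \<Rightarrow> 'y" +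
  fixes C :: "('y \<Rightarrow>\<^sub>L 'k) set"
  assumes C_subset: "C \<subseteq> dual scl \<inter> sphere 0 1"
    and C_norming: "dual scl \<inter> cball 0 1 = weak_star_topology scl closure_of (convex hull C)"
begin

lemma C_norm_le:
  assumes "c \<in> C"
  shows "norm (blinfun_apply c v) \<le> norm v"
  using norm_blinfun[of c v] assms C_subset by auto

lemma C_scale:
  assumes "c \<in> C"
  shows "blinfun_apply c (scl a v) = a * blinfun_apply c v"
  using assms C_subset by (auto simp: dual_def)

text \<open>A Hahn-Banach functional at \<open>y\<close> lies in the weak-star open half-space of
  functionals with real part above \<open>b\<close> at \<open>y\<close>. That half-space therefore
  meets the convex hull of \<open>C\<close>, and then \<open>C\<close> itself, because its
  complement is convex.\<close>

lemma C_norming_re: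
  assumes "b < norm y"
  obtains c where "c \<in> C" "b < scalar_re (blinfun_apply c y)"
proof -
  obtain f where f: "f \<in> dual scl \<inter> cball 0 1" "blinfun_apply f y = of_real (norm y)"
    using Hahn_Banach_dual by blast
  define U where "U = {h :: 'y \<Rightarrow> 'k. b < scalar_re (h y)}"
  have "open U"
    unfolding U_def
    by (intro open_Collect_less continuous_on_const
        bounded_linear.continuous_on[OF bounded_linear_scalar_re] continuous_on_product_coordinates)
  then have "openin (weak_star_topology scl) (blinfun_apply -` U \<inter> dual scl)"
    unfolding weak_star_topology_def openin_pullback_topology by auto
  moreover have "f \<in> blinfun_apply -` U \<inter> dual scl"
    using f assms by (simp add: U_def)
  moreover have "f \<in> weak_star_topology scl closure_of (convex hull C)"
    using f(1) C_norming by blast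
  ultimately obtain g where "g \<in> convex hull C" "g \<in> blinfun_apply -` U \<inter> dual scl"
    by (meson in_closure_of)
  then have g: "g \<in> convex hull C" "b < scalar_re (blinfun_apply g y)"
    by (simp_all add: U_def)
  have "\<exists>c\<in>C. b < scalar_re (blinfun_apply c y)"
  proof (rule ccontr)
    assume "\<not> ?thesis"
    then have "C \<subseteq> {g. scalar_re (blinfun_apply g y) \<le> b}" by force
    moreover have "linear (\<lambda>g. scalar_re (blinfun_apply g y))"
      by (intro linearI) (simp_all add: blinfun.add_left blinfun.scaleR_left
          linear_add[OF linear_scalar_re] linear_cmul[OF linear_scalar_re])
    then have "convex {g. scalar_re (blinfun_apply g y) \<le> b}"
      using convex_linear_vimage[of "\<lambda>g. scalar_re (blinfun_apply g y)" "{..b}"] by (simp add: vimage_def)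
    ultimately have "convex hull C \<subseteq> {g. scalar_re (blinfun_apply g y) \<le> b}"
      by (rule hull_minimal)
    then show False using g by auto
  qed
  then show ?thesis using that by blast
qed

lemma norm_C_ball_le:
  assumes "bounded (P ` cball 0 1)" "x \<in> cball 0 1" "c \<in> C"
  shows "norm (blinfun_apply c (P x)) \<le> ball_norm P"
  using norm_le_ball_norm[OF assms(1,2)] C_norm_le[OF assms(3)] order_trans by blast

lemma ex_almost_norming:
  assumes "b < ball_norm R"
  obtains x c where "x \<in> cball 0 1" "c \<in> C" "b < scalar_re (blinfun_apply c (R x))"
  using less_ball_normE[OF assms] C_norming_re by metis

text \<open>Tolerances \<open>1 / (n + 1)\<close> turn approximating pairs into sequences. In this
  form closedness and explicit membership need no choice of sequences.\<close>

lemma norming_limits_iff: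
  "l \<in> norming_limits C P Q \<longleftrightarrow>
    (\<forall>e>0. \<exists>x\<in>cball 0 1. \<exists>c\<in>C. dist (blinfun_apply c (P x)) (of_real (ball_norm P)) < e \<and>
       dist (blinfun_apply c (Q x)) l < e)" (is "_ \<longleftrightarrow> ?R")
proof
  assume "l \<in> norming_limits C P Q"
  then obtain x c where xc: "\<And>n::nat. x n \<in> cball 0 1" "\<And>n. c n \<in> C"
    and P: "(\<lambda>n. blinfun_apply (c n) (P (x n))) \<longlonglongrightarrow> of_real (ball_norm P)"
    and Q: "(\<lambda>n. blinfun_apply (c n) (Q (x n))) \<longlonglongrightarrow> l"
    unfolding norming_limits_def by blast
  show ?R
  proof (intro allI impI)
    fix e :: real assume "e > 0"
    then have "\<forall>\<^sub>F n in sequentially. dist (blinfun_apply (c n) (P (x n))) (of_real (ball_norm P)) < e \<and>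
       dist (blinfun_apply (c n) (Q (x n))) l < e"
      using P Q by (intro eventually_conj tendstoD)
    from eventually_happens'[OF sequentially_bot this]
    show "\<exists>x\<in>cball 0 1. \<exists>c\<in>C. dist (blinfun_apply c (P x)) (of_real (ball_norm P)) < e \<and>
       dist (blinfun_apply c (Q x)) l < e"
      using xc by blast
  qed
next
  assume R: ?R
  have "\<exists>x c. x \<in> cball 0 1 \<and> c \<in> C \<and>
      dist (blinfun_apply c (P x)) (of_real (ball_norm P)) < inverse (real (Suc n)) \<and>
      dist (blinfun_apply c (Q x)) l < inverse (real (Suc n))" for n
    using R[rule_format, of "inverse (real (Suc n))"] by auto
  then obtain x c where xc: "\<And>n. x n \<in> cball 0 1 \<and> c n \<in> C"
      "\<And>n. dist (blinfun_apply (c n) (P (x n))) (of_real (ball_norm P)) < inverse (real (Suc n))"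
      "\<And>n. dist (blinfun_apply (c n) (Q (x n))) l < inverse (real (Suc n))"
    by metis
  have "(\<lambda>n. blinfun_apply (c n) (P (x n))) \<longlonglongrightarrow> of_real (ball_norm P)"
    and "(\<lambda>n. blinfun_apply (c n) (Q (x n))) \<longlonglongrightarrow> l"
    unfolding tendsto_dist_iff[of _ "of_real _"] tendsto_dist_iff[of _ l]
    by (rule tendsto_sandwich[OF _ _ tendsto_const LIMSEQ_inverse_real_of_nat];
        use xc in \<open>simp add: less_imp_le\<close>)+
  then show "l \<in> norming_limits C P Q"
    unfolding norming_limits_def using xc(1) by blast
qed

text \<open>Only real parts at \<open>P\<close> are assumed to converge; the bound by
  \<open>ball_norm P\<close> upgrades this to convergence of the values. The values at
  \<open>Q\<close> are bounded scalars, so a subsequence of them converges.\<close>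

lemma norming_limits_subsequence:
  assumes P: "bounded (P ` cball 0 1)" and Q: "bounded (Q ` cball 0 1)"
    and xc: "\<And>n::nat. x n \<in> cball 0 1" "\<And>n. c n \<in> C"
    and re: "(\<lambda>n. scalar_re (blinfun_apply (c n) (P (x n)))) \<longlonglongrightarrow> ball_norm P"
  obtains l r where "strict_mono r" "l \<in> norming_limits C P Q"
    "(\<lambda>n. blinfun_apply (c (r n)) (P (x (r n)))) \<longlonglongrightarrow> of_real (ball_norm P)"
    "(\<lambda>n. blinfun_apply (c (r n)) (Q (x (r n)))) \<longlonglongrightarrow> l"
proof -
  have lim: "(\<lambda>n. blinfun_apply (c n) (P (x n))) \<longlonglongrightarrow> of_real (ball_norm P)"
    using norm_C_ball_le[OF P xc] re by (rule tendsto_norm_bound_if_scalar_re)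
  have "bounded (range (\<lambda>n. blinfun_apply (c n) (Q (x n))))"
    using norm_C_ball_le[OF Q xc] by (auto simp: bounded_iff)
  then obtain l r where r: "strict_mono r" "(\<lambda>n. blinfun_apply (c (r n)) (Q (x (r n)))) \<longlonglongrightarrow> l"
    using bounded_imp_convergent_subsequence[of "\<lambda>n. blinfun_apply (c n) (Q (x n))"] by (auto simp: o_def)
  have lim': "(\<lambda>n. blinfun_apply (c (r n)) (P (x (r n)))) \<longlonglongrightarrow> of_real (ball_norm P)"
    using LIMSEQ_subseq_LIMSEQ[OF lim r(1)] by (simp add: o_def)
  have "l \<in> norming_limits C P Q"
    unfolding norming_limits_def using lim' r(2) xc
    by (intro CollectI exI[of _ "x \<circ> r"] exI[of _ "c \<circ> r"]) simp
  then show ?thesis using that r lim' by blast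
qed

lemma norm_norming_limit_le:
  assumes Q: "bounded (Q ` cball 0 1)" and l: "l \<in> norming_limits C P Q"
  shows "norm l \<le> ball_norm Q"
proof -
  obtain x c where xc: "\<And>n::nat. x n \<in> cball 0 1" "\<And>n. c n \<in> C"
    and lim: "(\<lambda>n. blinfun_apply (c n) (Q (x n))) \<longlonglongrightarrow> l"
    using l unfolding norming_limits_def by blast
  show ?thesis
    using norm_C_ball_le[OF Q xc] by (intro LIMSEQ_le_const2[OF tendsto_norm[OF lim]]) blast
qed

text \<open>The limits are bounded by \<open>ball_norm Q\<close>, and a limit of limits is
  approximated by pairs with half the tolerance. Compactness is what makes strict separation from
  \<open>0\<close> possible.\<close>

lemma compact_norming_limits:
  assumes Q: "bounded (Q ` cball 0 1)"
  shows "compact (norming_limits C P Q)"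
proof -
  have "bounded (norming_limits C P Q)"
    unfolding bounded_iff using norm_norming_limit_le[OF Q] by blast
  moreover have "closed (norming_limits C P Q)"
    unfolding closure_subset_eq[symmetric]
  proof
    fix l assume "l \<in> closure (norming_limits C P Q)"
    then have l: "\<forall>e>0. \<exists>k\<in>norming_limits C P Q. dist k l < e"
      by (simp only: closure_approachable)
    show "l \<in> norming_limits C P Q"
      unfolding norming_limits_iff
    proof (intro allI impI)
      fix e :: real assume "e > 0"
      then have "e / 2 > 0" by simp
      then obtain k where k: "k \<in> norming_limits C P Q" "dist k l < e / 2"
        using l by blast
      obtain x c where "x \<in> cball 0 1" "c \<in> C"
        "dist (blinfun_apply c (P x)) (of_real (ball_norm P)) < e / 2"
        "dist (blinfun_apply c (Q x)) k < e / 2"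
        using k(1) \<open>e / 2 > 0\<close> unfolding norming_limits_iff by blast
      then show "\<exists>x\<in>cball 0 1. \<exists>c\<in>C. dist (blinfun_apply c (P x)) (of_real (ball_norm P)) < e \<and>
          dist (blinfun_apply c (Q x)) l < e"
        using k(2) dist_triangle_half_r[of k "blinfun_apply c (Q x)" e l] \<open>e / 2 > 0\<close>
        by (intro bexI[of _ x] bexI[of _ c]) (auto simp: dist_commute)
    qed
  qed
  ultimately show ?thesis by (simp add: compact_eq_bounded_closed)
qed

lemma bounded_pointwise_scale:
  assumes "bounded (Q ` cball 0 1)"
  shows "bounded (pointwise_scale scl a Q ` cball 0 1)"
proof -
  obtain b where "\<forall>x\<in>cball 0 1. norm (Q x) \<le> b"
    using assms unfolding bounded_iff by blast
  then have "\<forall>y\<in>pointwise_scale scl a Q ` cball 0 1. norm y \<le> norm a * b"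
    by (auto simp: pointwise_scale_def norm_scale mult_left_mono)
  then show ?thesis
    unfolding bounded_iff by blast
qed

lemma bounded_add:
  fixes P Q :: "'v::real_normed_vector \<Rightarrow> 'y"
  assumes "bounded (P ` cball 0 1)" "bounded (Q ` cball 0 1)"
  shows "bounded ((P + Q) ` cball 0 1)"
  using bounded_plus_comp[OF assms] by (simp add: plus_fun_def)

text \<open>The left side is the norm of the limit of \<open>P + a Q\<close> evaluated along the
  sequence that yields \<open>l\<close>, and each such value is bounded by the norm on the
  right.\<close>

lemma ball_norm_add_ge_norming_limit:
  assumes P: "bounded (P ` cball 0 1)" and Q: "bounded (Q ` cball 0 1)"
    and l: "l \<in> norming_limits C P Q"
  shows "norm (of_real (ball_norm P) + a * l) \<le> ball_norm (P + pointwise_scale scl a Q)"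
proof -
  let ?R = "P + pointwise_scale scl a Q"
  obtain x c where xc: "\<And>n::nat. x n \<in> cball 0 1" "\<And>n. c n \<in> C"
    and "(\<lambda>n. blinfun_apply (c n) (P (x n))) \<longlonglongrightarrow> of_real (ball_norm P)"
        "(\<lambda>n. blinfun_apply (c n) (Q (x n))) \<longlonglongrightarrow> l"
    using l unfolding norming_limits_def by blast
  then have "(\<lambda>n. blinfun_apply (c n) (P (x n)) + a * blinfun_apply (c n) (Q (x n)))
      \<longlonglongrightarrow> of_real (ball_norm P) + a * l"
    by (intro tendsto_intros)
  then have lim: "(\<lambda>n. blinfun_apply (c n) (?R (x n))) \<longlonglongrightarrow> of_real (ball_norm P) + a * l"
    by (simp add: pointwise_scale_def blinfun.add_right C_scale xc(2))
  have "bounded (?R ` cball 0 1)"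
    using bounded_add P bounded_pointwise_scale Q by blast
  then show ?thesis
    using norm_C_ball_le[OF _ xc] by (intro LIMSEQ_le_const2[OF tendsto_norm[OF lim]]) blast
qed

text \<open>Over the zero space no functional has norm one, so \<open>C\<close> would be empty; but
  the closure of its hull contains the zero functional.\<close>

lemma ex_nonzero_vector:
  obtains y :: 'y where "y \<noteq> 0"
proof -
  have "(0 :: 'y \<Rightarrow>\<^sub>L 'k) \<in> dual scl \<inter> cball 0 1"
    by (simp add: dual_def)
  then have "convex hull C \<noteq> {}"
    unfolding C_norming by (metis closure_of_empty empty_iff)
  then obtain c where c: "c \<in> C" by auto
  then have "norm c = 1" using C_subset by auto
  then have "c \<noteq> 0" by auto
  then obtain y where "blinfun_apply c y \<noteq> 0"
    by (metis blinfun_eqI zero_blinfun.rep_eq)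
  then have "y \<noteq> 0" by auto
  then show ?thesis by (rule that)
qed

lemma ex_norming_sequence:
  assumes P: "bounded (P ` cball 0 1)"
  obtains x c where "\<And>n::nat. x n \<in> cball 0 1" "\<And>n. c n \<in> C"
    "(\<lambda>n. scalar_re (blinfun_apply (c n) (P (x n)))) \<longlonglongrightarrow> ball_norm P"
proof -
  have "\<exists>x c. x \<in> cball 0 1 \<and> c \<in> C \<and>
      ball_norm P - inverse (real (Suc n)) < scalar_re (blinfun_apply c (P x))" for n
  proof -
    have "ball_norm P - inverse (real (Suc n)) < ball_norm P" by simp
    then show ?thesis by (rule ex_almost_norming) blast
  qed
  then obtain x c where xc: "\<And>n. x n \<in> cball 0 1" "\<And>n. c n \<in> C" and
    lower: "\<And>n. ball_norm P - inverse (real (Suc n)) \<le> scalar_re (blinfun_apply (c n) (P (x n)))"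
    by (metis less_imp_le)
  have upper: "scalar_re (blinfun_apply (c n) (P (x n))) \<le> ball_norm P" for n
    by (rule order_trans[OF scalar_re_le_norm norm_C_ball_le[OF P xc]])
  have "(\<lambda>n. ball_norm P - inverse (real (Suc n))) \<longlonglongrightarrow> ball_norm P"
    using tendsto_diff[OF tendsto_const LIMSEQ_inverse_real_of_nat, of "ball_norm P"] by simp
  from tendsto_sandwich[OF always_eventually[OF allI[OF lower]] always_eventually[OF allI[OF upper]]
      this tendsto_const]
  show ?thesis using that xc by blast
qed

text \<open>Two successive extractions serve \<open>Q\<close> and \<open>R\<close> with the same
  pairs, so that limits can be added.\<close>

lemma ex_common_norming_sequence:
  assumes P: "bounded (P ` cball 0 1)" and Q: "bounded (Q ` cball 0 1)" and R: "bounded (R ` cball 0 1)"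
  obtains x c q r where "\<And>n::nat. x n \<in> cball 0 1" "\<And>n. c n \<in> C"
    "(\<lambda>n. blinfun_apply (c n) (P (x n))) \<longlonglongrightarrow> of_real (ball_norm P)"
    "(\<lambda>n. blinfun_apply (c n) (Q (x n))) \<longlonglongrightarrow> q" "q \<in> norming_limits C P Q"
    "(\<lambda>n. blinfun_apply (c n) (R (x n))) \<longlonglongrightarrow> r" "r \<in> norming_limits C P R"
proof -
  obtain x c where xc: "\<And>n::nat. x n \<in> cball 0 1" "\<And>n. c n \<in> C"
    and re: "(\<lambda>n. scalar_re (blinfun_apply (c n) (P (x n)))) \<longlonglongrightarrow> ball_norm P"
    by (rule ex_norming_sequence[OF P]) blast
  obtain q s where s: "q \<in> norming_limits C P Q" "strict_mono s"
    "(\<lambda>n. blinfun_apply (c (s n)) (P (x (s n)))) \<longlonglongrightarrow> of_real (ball_norm P)"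
    "(\<lambda>n. blinfun_apply (c (s n)) (Q (x (s n)))) \<longlonglongrightarrow> q"
    by (rule norming_limits_subsequence[OF P Q xc re]) blast
  have re': "(\<lambda>n. scalar_re (blinfun_apply (c (s n)) (P (x (s n))))) \<longlonglongrightarrow> ball_norm P"
    using bounded_linear.tendsto[OF bounded_linear_scalar_re s(3)] by simp
  obtain r u where u: "r \<in> norming_limits C P R" "strict_mono u"
    "(\<lambda>n. blinfun_apply (c (s (u n))) (P (x (s (u n))))) \<longlonglongrightarrow> of_real (ball_norm P)"
    "(\<lambda>n. blinfun_apply (c (s (u n))) (R (x (s (u n))))) \<longlonglongrightarrow> r"
    by (rule norming_limits_subsequence[OF P R xc(1) xc(2) re']) blast
  have "(\<lambda>n. blinfun_apply (c (s (u n))) (Q (x (s (u n))))) \<longlonglongrightarrow> q"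
    using LIMSEQ_subseq_LIMSEQ[OF s(4) u(2)] by (simp add: o_def)
  then show ?thesis
    using that[of "\<lambda>n. x (s (u n))" "\<lambda>n. c (s (u n))" q r] xc u s(1) by blast
qed

lemma norming_limits_nonempty:
  assumes P: "bounded (P ` cball 0 1)" and Q: "bounded (Q ` cball 0 1)"
  shows "norming_limits C P Q \<noteq> {}"
  by (rule ex_common_norming_sequence[OF P Q Q]) blast

lemma norming_limits_self:
  assumes "l \<in> norming_limits C P P"
  shows "l = of_real (ball_norm P)"
  using assms LIMSEQ_unique unfolding norming_limits_def by blast

lemma norming_limits_pointwise_scale:
  assumes "l \<in> norming_limits C P Q"
  shows "a * l \<in> norming_limits C P (pointwise_scale scl a Q)"
proof -
  obtain x c where xc: "\<And>n::nat. x n \<in> cball 0 1 \<and> c n \<in> C"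
    and P: "(\<lambda>n. blinfun_apply (c n) (P (x n))) \<longlonglongrightarrow> of_real (ball_norm P)"
    and Q: "(\<lambda>n. blinfun_apply (c n) (Q (x n))) \<longlonglongrightarrow> l"
    using assms unfolding norming_limits_def by blast
  have "blinfun_apply (c n) (pointwise_scale scl a Q (x n)) = a * blinfun_apply (c n) (Q (x n))" for n
    using xc C_scale by (simp add: pointwise_scale_def)
  then have "(\<lambda>n. blinfun_apply (c n) (pointwise_scale scl a Q (x n))) \<longlonglongrightarrow> a * l"
    using tendsto_mult_left[OF Q, of a] by simp
  then show ?thesis
    unfolding norming_limits_def using xc P by blast
qed

text \<open>When \<open>P\<close> vanishes on the ball, the point \<open>0\<close> with any
  functional in \<open>C\<close> norms it, so all values \<open>c y\<close> are limits. For
  \<open>y\<close> nonzero, real parts of both signs occur among them, as \<open>C\<close> norms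
  both \<open>y\<close> and \<open>- y\<close>.\<close>

lemma norming_limits_const_not_singleton:
  fixes P :: "'x::banach \<Rightarrow> 'y"
  assumes P: "bounded (P ` cball 0 1)" and zero: "ball_norm P = 0"
  obtains y where "\<not> is_singleton (norming_limits C P (\<lambda>_. y))"
proof -
  obtain y :: 'y where "y \<noteq> 0" by (rule ex_nonzero_vector)
  then have y: "0 < norm y" by simp
  have mem: "blinfun_apply c y \<in> norming_limits C P (\<lambda>_. y)" if c: "c \<in> C" for c
  proof -
    have "blinfun_apply c (P 0) = 0"
      using norm_C_ball_le[OF P _ c, of 0] zero by simp
    then show ?thesis
      unfolding norming_limits_iff using c zero by (intro allI impI bexI[of _ 0] bexI[of _ c]) simp_all
  qed
  obtain c where c: "c \<in> C" "0 < scalar_re (blinfun_apply c y)"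
    using C_norming_re[OF y] by blast
  have "0 < norm (- y)" using y by simp
  then obtain d where d: "d \<in> C" "0 < scalar_re (blinfun_apply d (- y))"
    by (rule C_norming_re)
  then have "scalar_re (blinfun_apply d y) < 0"
    by (simp add: blinfun.minus_right linear_neg[OF linear_scalar_re])
  then have "blinfun_apply c y \<noteq> blinfun_apply d y"
    using c(2) by force
  then have "\<not> is_singleton (norming_limits C P (\<lambda>_. y))"
    using mem[OF c(1)] mem[OF d(1)] by (metis is_singletonE singletonD)
  then show ?thesis by (rule that)
qed

section \<open>Birkhoff-James orthogonality\<close>

text \<open>For fixed \<open>a\<close>, the scalars \<open>l\<close> satisfying the lower estimate
  for \<open>P + a Q\<close> form a convex set, the preimage of a ball under multiplication. It
  contains all limits, hence \<open>0\<close>.\<close>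

lemma birkhoff_orthogonal_if_convex_hull:
  assumes P: "bounded (P ` cball 0 1)" and Q: "bounded (Q ` cball 0 1)"
    and 0: "0 \<in> convex hull (norming_limits C P Q)"
  shows "birkhoff_orthogonal (pointwise_scale scl) ball_norm P Q"
  unfolding birkhoff_orthogonal_def
proof
  fix a
  let ?b = "ball_norm (P + pointwise_scale scl a Q)"
  have "convex {l. norm (of_real (ball_norm P) + a * l) \<le> ?b}"
  proof -
    have "{l. norm (of_real (ball_norm P) + a * l) \<le> ?b}
        = (\<lambda>l. a * l) -` cball (- of_real (ball_norm P)) ?b"
      by (auto simp: dist_norm norm_minus_commute[of "- of_real (ball_norm P)"] add.commute)
    then show ?thesis
      by (simp add: convex_linear_vimage bounded_linear.linear[OF bounded_linear_mult_right])
  qed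
  then have "convex hull (norming_limits C P Q) \<subseteq> {l. norm (of_real (ball_norm P) + a * l) \<le> ?b}"
    using ball_norm_add_ge_norming_limit[OF P Q] by (intro hull_minimal) auto
  then have "norm (of_real (ball_norm P) :: 'k) \<le> ?b"
    using 0 by auto
  then show "ball_norm P \<le> ?b"
    using ball_norm_nonneg[OF P] by simp
qed

text \<open>If \<open>0\<close> is not in the hull, a scalar \<open>a\<close> moves all limits into the open left half plane. Almost
  norming pairs for \<open>P + (a / n) Q\<close> are almost norming for \<open>P\<close>, and orthogonality keeps the real
  part of their values at \<open>a Q\<close> above \<open>- 1 / n\<close>.\<close>

lemma convex_hull_if_birkhoff_orthogonal:
  assumes P: "bounded (P ` cball 0 1)" and Q: "bounded (Q ` cball 0 1)"
    and orth: "birkhoff_orthogonal (pointwise_scale scl) ball_norm P Q"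
  shows "0 \<in> convex hull (norming_limits C P Q)"
proof (rule ccontr)
  assume "0 \<notin> convex hull (norming_limits C P Q)"
  then obtain a where a: "\<And>l. l \<in> norming_limits C P Q \<Longrightarrow> scalar_re (a * l) < 0"
    using scalar_separation compact_norming_limits[OF Q] by metis
  define t where "t n = inverse (real (Suc n))" for n
  have t: "t n > 0" "t \<longlonglongrightarrow> 0" for n
    unfolding t_def by (simp_all add: LIMSEQ_inverse_real_of_nat del: of_nat_Suc)
  \<comment> \<open>The error is quadratic in \<open>t n\<close>, so that it still tends to
    \<open>0\<close> after division by \<open>t n\<close>.\<close>
  have "\<exists>x c. x \<in> cball 0 1 \<and> c \<in> C \<and> ball_norm P - t n * t n <
      scalar_re (blinfun_apply c (P x)) + t n * scalar_re (a * blinfun_apply c (Q x))" for n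
  proof -
    let ?R = "P + pointwise_scale scl (of_real (t n) * a) Q"
    have "ball_norm P - t n * t n < ball_norm ?R"
      using orth[unfolded birkhoff_orthogonal_def, rule_format, of "of_real (t n) * a"]
        mult_pos_pos[OF t(1)[of n] t(1)[of n]] by linarith
    then obtain x c where xc: "x \<in> cball 0 1" "c \<in> C"
        "ball_norm P - t n * t n < scalar_re (blinfun_apply c (?R x))"
      by (rule ex_almost_norming)
    have "blinfun_apply c (?R x) = blinfun_apply c (P x) + of_real (t n) * (a * blinfun_apply c (Q x))"
      by (simp only: plus_fun_apply pointwise_scale_def blinfun.add_right C_scale[OF xc(2)] mult.assoc)
    then have "scalar_re (blinfun_apply c (?R x))
        = scalar_re (blinfun_apply c (P x)) + t n * scalar_re (a * blinfun_apply c (Q x))"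
      by (simp only: linear_add[OF linear_scalar_re] scalar_re_of_real_mult)
    then show ?thesis using xc by auto
  qed
  then obtain x c where xc: "\<And>n. x n \<in> cball 0 1" "\<And>n. c n \<in> C" and almost:
    "\<And>n. ball_norm P - t n * t n <
      scalar_re (blinfun_apply (c n) (P (x n))) + t n * scalar_re (a * blinfun_apply (c n) (Q (x n)))"
    by metis
  have Pn: "scalar_re (blinfun_apply (c n) (P (x n))) \<le> ball_norm P" for n
    by (rule order_trans[OF scalar_re_le_norm norm_C_ball_le[OF P xc]])
  have Qn: "scalar_re (a * blinfun_apply (c n) (Q (x n))) \<le> norm a * ball_norm Q" for n
    using mult_left_mono[OF norm_C_ball_le[OF Q xc(1)[of n] xc(2)[of n]] norm_ge_zero[of a]]
      scalar_re_le_norm[of "a * blinfun_apply (c n) (Q (x n))"] by (simp add: norm_mult)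
  \<comment> \<open>The perturbation has size of order \<open>t n\<close>, so the chosen pairs are
    norming for \<open>P\<close> as well.\<close>
  have lower: "ball_norm P - t n * (t n + norm a * ball_norm Q) \<le> scalar_re (blinfun_apply (c n) (P (x n)))" for n
    using almost[of n] mult_left_mono[OF Qn[of n] less_imp_le[OF t(1)[of n]]]
    unfolding distrib_left by linarith
  have "(\<lambda>n. ball_norm P - t n * (t n + norm a * ball_norm Q)) \<longlonglongrightarrow> ball_norm P"
    using t(2) by (auto intro!: tendsto_eq_intros)
  from tendsto_sandwich[OF always_eventually[OF allI[OF lower]] always_eventually[OF allI[OF Pn]] this tendsto_const]
  have re: "(\<lambda>n. scalar_re (blinfun_apply (c n) (P (x n)))) \<longlonglongrightarrow> ball_norm P" .
  obtain l r where r: "strict_mono r" "l \<in> norming_limits C P Q"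
      "(\<lambda>n. blinfun_apply (c (r n)) (Q (x (r n)))) \<longlonglongrightarrow> l"
    by (rule norming_limits_subsequence[OF P Q xc re]) blast
  \<comment> \<open>The part at \<open>P\<close> is at most \<open>ball_norm P\<close>; cancelling
    it and dividing by \<open>t n\<close> leaves the bound on the part at \<open>Q\<close>.\<close>
  have bound: "- t n \<le> scalar_re (a * blinfun_apply (c n) (Q (x n)))" for n
  proof -
    have "t n * - t n \<le> t n * scalar_re (a * blinfun_apply (c n) (Q (x n)))"
      using almost[of n] Pn[of n] by simp
    then show ?thesis using t(1)[of n] by (simp only: mult_le_cancel_left_pos)
  qed
  have "(\<lambda>n. - t (r n)) \<longlonglongrightarrow> 0"
    using tendsto_minus[OF LIMSEQ_subseq_LIMSEQ[OF t(2) r(1)]] by (simp add: o_def)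
  moreover have "(\<lambda>n. scalar_re (a * blinfun_apply (c (r n)) (Q (x (r n))))) \<longlonglongrightarrow> scalar_re (a * l)"
    using r(3) by (intro bounded_linear.tendsto[OF bounded_linear_scalar_re] tendsto_intros)
  ultimately have "0 \<le> scalar_re (a * l)"
    by (rule LIMSEQ_le) (use bound in blast)
  then show False using a[OF r(2)] by simp
qed

end

section \<open>Smooth points\<close>

text \<open>By Tychonoff's theorem. Only finitely many points are controlled by one reindexing \<open>r\<close>: in
  general no subsequence converges at all points of \<open>Z\<close>.\<close>

lemma pointwise_bounded_cluster_point:
  fixes f :: "nat \<Rightarrow> 'z \<Rightarrow> 'k::heine_borel"
  assumes bdd: "\<And>z. z \<in> Z \<Longrightarrow> bounded (range (\<lambda>n. f n z))"
  obtains g where "g \<in> extensional Z"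
    "\<And>A. finite A \<Longrightarrow> A \<subseteq> Z \<Longrightarrow>
       \<exists>r. filterlim r sequentially sequentially \<and> (\<forall>z\<in>A. (\<lambda>n. f (r n) z) \<longlonglongrightarrow> g z)"
proof -
  let ?X = "product_topology (\<lambda>_. euclidean :: 'k topology) Z"
  define K where "K = (\<Pi>\<^sub>E z\<in>Z. closure (range (\<lambda>n. f n z)))"
  define h where "h n = restrict (f n) Z" for n
  \<comment> \<open>A point common to the closures of all tails is a cluster point; compactness of
    \<open>K\<close> provides one through the finite intersection property.\<close>
  define F where "F n = ?X closure_of (h ` {n..})" for n
  have hK: "h n \<in> K" for n
    using closure_subset by (fastforce simp: h_def K_def)
  have "compactin ?X K"
    using bdd by (auto simp: K_def compactin_PiE compact_closure)
  moreover have "\<forall>C\<in>range F. closedin ?X C"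
    by (auto simp: F_def)
  moreover have "K \<inter> \<Inter>\<F> \<noteq> {}" if fin: "finite \<F>" "\<F> \<subseteq> range F" for \<F>
  proof -
    obtain N where N: "finite N" "\<F> = F ` N"
      using finite_subset_image[OF fin] by blast
    \<comment> \<open>Inserting \<open>0\<close> covers the empty family, for which
      \<open>Max N\<close> would be unspecified.\<close>
    have "h (Max (insert 0 N)) \<in> F n" if "n \<in> N" for n
    proof -
      have "h ` {n..} \<subseteq> topspace ?X"
        by (auto simp: h_def)
      then have "h ` {n..} \<subseteq> F n"
        unfolding F_def by (rule closure_of_subset)
      then show ?thesis using that N(1) by auto
    qed
    then show ?thesis using hK N(2) by blast
  qed
  ultimately have "K \<inter> \<Inter>(range F) \<noteq> {}"
    unfolding compactin_fip by blast
  then obtain g where g: "g \<in> K" "\<And>n. g \<in> F n" by blast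
  show ?thesis
  proof (rule that)
    show "g \<in> extensional Z"
      using g(1) by (auto simp: K_def PiE_def)
    fix A assume A: "finite A" "A \<subseteq> Z"
    have "\<exists>m\<ge>n. \<forall>z\<in>A. dist (f m z) (g z) < inverse (real (Suc n))" for n
    proof -
      define U where "U = (\<Pi>\<^sub>E z\<in>Z. if z \<in> A then ball (g z) (inverse (real (Suc n))) else UNIV)"
      have "{z \<in> Z. (if z \<in> A then ball (g z) (inverse (real (Suc n))) else UNIV)
          \<noteq> topspace (euclidean :: 'k topology)} \<subseteq> A"
        by auto
      then have "openin ?X U"
        unfolding U_def openin_PiE_gen using A finite_subset by auto
      moreover have "g \<in> U"
        using g(1) by (auto simp: U_def K_def)
      ultimately obtain m where m: "m \<ge> n" "h m \<in> U"
        using g(2)[of n] unfolding F_def in_closure_of by blast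
      have "dist (f m z) (g z) < inverse (real (Suc n))" if "z \<in> A" for z
      proof -
        have "h m z \<in> ball (g z) (inverse (real (Suc n)))"
          using PiE_mem[OF m(2)[unfolded U_def], of z] that A(2) by auto
        then show ?thesis
          using that A(2) by (auto simp: h_def dist_commute)
      qed
      then show ?thesis
        using m(1) by blast
    qed
    \<comment> \<open>The indices need not increase; \<open>r n \<ge> n\<close> already sends them
      to infinity.\<close>
    then obtain r where r: "\<And>n. r n \<ge> n"
        "\<And>n z. z \<in> A \<Longrightarrow> dist (f (r n) z) (g z) < inverse (real (Suc n))"
      by metis
    have "filterlim r sequentially sequentially"
      by (rule filterlim_at_top_mono[OF filterlim_ident always_eventually[OF allI[OF r(1)]]])
    moreover have "(\<lambda>n. f (r n) z) \<longlonglongrightarrow> g z" if "z \<in> A" for z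
      unfolding tendsto_dist_iff[of _ "g z"]
      by (rule tendsto_sandwich[OF _ _ tendsto_const LIMSEQ_inverse_real_of_nat])
         (use r(2)[OF that] in \<open>simp_all add: less_imp_le\<close>)
    ultimately show "\<exists>r. filterlim r sequentially sequentially \<and> (\<forall>z\<in>A. (\<lambda>n. f (r n) z) \<longlonglongrightarrow> g z)"
      by blast
  qed
qed

section \<open>Support functionals on a space of bounded functions\<close>

definition support_functionals ::
    "('k::real_or_complex \<Rightarrow> 'z \<Rightarrow> 'z) \<Rightarrow> 'z::ab_group_add set \<Rightarrow> ('z \<Rightarrow> real) \<Rightarrow> 'z \<Rightarrow> ('z \<Rightarrow> 'k) set" where
  "support_functionals scl Z nrm z =
     {\<phi> \<in> functionals_on scl Z nrm. functional_norm Z nrm \<phi> = 1 \<and> \<phi> z = of_real (nrm z)}"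

locale bounded_function_space = norming_set scl C
  for scl :: "'k::real_or_complex \<Rightarrow> 'y::banach \<Rightarrow> 'y" and C :: "('y \<Rightarrow>\<^sub>L 'k) set" +
  fixes Z :: "('x::banach \<Rightarrow> 'y) set"
  assumes Z_bounded: "P \<in> Z \<Longrightarrow> bounded (P ` cball 0 1)"
    and Z_add: "P \<in> Z \<Longrightarrow> Q \<in> Z \<Longrightarrow> P + Q \<in> Z"
    and Z_scale: "P \<in> Z \<Longrightarrow> pointwise_scale scl a P \<in> Z"
    and Z_const: "(\<lambda>_. y) \<in> Z"
begin

abbreviation "support \<equiv> support_functionals (pointwise_scale scl) Z ball_norm"

lemma ball_norm_normalized:
  assumes "P \<in> Z" "0 < ball_norm P"
  shows "ball_norm (pointwise_scale scl (of_real (inverse (ball_norm P))) P) \<le> 1"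
proof (rule ball_norm_le)
  fix x :: 'x assume "x \<in> cball 0 1"
  then have "norm (P x) \<le> ball_norm P"
    by (rule norm_le_ball_norm[OF Z_bounded[OF assms(1)]])
  then show "norm (pointwise_scale scl (of_real (inverse (ball_norm P))) P x) \<le> 1"
    using assms(2) by (simp add: pointwise_scale_def norm_scale norm_inverse norm_divide field_simps)
qed

text \<open>Normalizing \<open>R\<close> reduces to the supremum defining the dual norm, which is
  bounded above thanks to \<open>B\<close>. In the abstract space \<open>ball_norm\<close> is
  treated as a seminorm, so \<open>ball_norm R = 0\<close> is settled by \<open>B\<close>
  directly.\<close>

lemma functional_le:
  assumes \<phi>: "\<phi> \<in> functionals_on (pointwise_scale scl) Z ball_norm"
    and norm: "functional_norm Z ball_norm \<phi> = 1" and R: "R \<in> Z"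
  shows "norm (\<phi> R) \<le> ball_norm R"
proof -
  obtain B where B: "\<And>R. R \<in> Z \<Longrightarrow> norm (\<phi> R) \<le> B * ball_norm R"
    using \<phi> unfolding functionals_on_def by blast
  show ?thesis
  proof (cases "0 < ball_norm R")
    case False
    then have "ball_norm R = 0"
      using ball_norm_nonneg[OF Z_bounded[OF R]] by simp
    then show ?thesis using B[OF R] by simp
  next
    case True
    let ?s = "inverse (ball_norm R)"
    let ?R = "pointwise_scale scl (of_real ?s) R"
    have "norm (\<phi> z) \<le> \<bar>B\<bar>" if z: "z \<in> {z \<in> Z. ball_norm z \<le> 1}" for z
    proof -
      have "0 \<le> ball_norm z" "ball_norm z \<le> 1"
        using z ball_norm_nonneg[OF Z_bounded] by auto
      then have "B * ball_norm z \<le> \<bar>B\<bar> * 1"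
        by (intro mult_mono) auto
      then show ?thesis using B[of z] z by simp
    qed
    then have "bdd_above ((\<lambda>z. norm (\<phi> z)) ` {z \<in> Z. ball_norm z \<le> 1})"
      by (rule bdd_aboveI2)
    moreover have "?R \<in> {z \<in> Z. ball_norm z \<le> 1}"
      using Z_scale[OF R] ball_norm_normalized[OF R True] by blast
    ultimately have "norm (\<phi> ?R) \<le> functional_norm Z ball_norm \<phi>"
      unfolding functional_norm_def by (intro cSUP_upper)
    moreover have "\<phi> ?R = of_real ?s * \<phi> R"
      using \<phi> R unfolding functionals_on_def by blast
    then have "norm (\<phi> ?R) = ?s * norm (\<phi> R)"
      using True by (simp only: norm_mult norm_of_real) simp
    ultimately have "?s * norm (\<phi> R) \<le> 1"
      using norm by simp
    then show ?thesis
      using True by (simp add: field_simps)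
  qed
qed

text \<open>The bound gives dual norm at most one, and the normalized \<open>P\<close> attains
  it.\<close>

lemma supportI:
  assumes ext: "\<phi> \<in> extensional Z"
    and add: "\<And>Q R. Q \<in> Z \<Longrightarrow> R \<in> Z \<Longrightarrow> \<phi> (Q + R) = \<phi> Q + \<phi> R"
    and scale: "\<And>a Q. Q \<in> Z \<Longrightarrow> \<phi> (pointwise_scale scl a Q) = a * \<phi> Q"
    and le: "\<And>Q. Q \<in> Z \<Longrightarrow> norm (\<phi> Q) \<le> ball_norm Q"
    and P: "P \<in> Z" "0 < ball_norm P" "\<phi> P = of_real (ball_norm P)"
  shows "\<phi> \<in> support P"
proof -
  let ?s = "inverse (ball_norm P)"
  let ?P = "pointwise_scale scl (of_real ?s) P"
  have "\<phi> \<in> functionals_on (pointwise_scale scl) Z ball_norm"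
    unfolding functionals_on_def using ext add scale le by (intro CollectI conjI exI[of _ 1] ballI allI IntI) simp_all
  moreover have "functional_norm Z ball_norm \<phi> = 1"
    unfolding functional_norm_def
  proof (rule cSup_eq_maximum)
    have "norm (\<phi> ?P) = 1"
      using scale[OF P(1)] P(2,3) by (simp add: norm_mult norm_inverse)
    then show "1 \<in> (\<lambda>z. norm (\<phi> z)) ` {z \<in> Z. ball_norm z \<le> 1}"
      using Z_scale[OF P(1)] ball_norm_normalized[OF P(1,2)] by (metis (mono_tags, lifting) image_eqI mem_Collect_eq)
  next
    fix b assume "b \<in> (\<lambda>z. norm (\<phi> z)) ` {z \<in> Z. ball_norm z \<le> 1}"
    then obtain z where "z \<in> Z" "ball_norm z \<le> 1" "b = norm (\<phi> z)" by blast
    then show "b \<le> 1" using le[of z] by simp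
  qed
  ultimately show ?thesis
    unfolding support_functionals_def using P(3) by blast
qed

text \<open>Adding a multiple of \<open>R\<close> does not change the value of \<phi>, which is
  \<open>ball_norm P\<close> and bounds the norm of the sum from below.\<close>

lemma birkhoff_orthogonal_kernel:
  assumes \<phi>: "\<phi> \<in> support P" and P: "P \<in> Z" and R: "R \<in> Z" and 0: "\<phi> R = 0"
  shows "birkhoff_orthogonal (pointwise_scale scl) ball_norm P R"
  unfolding birkhoff_orthogonal_def
proof
  fix a
  have \<phi>': "\<phi> \<in> functionals_on (pointwise_scale scl) Z ball_norm" "functional_norm Z ball_norm \<phi> = 1"
      "\<phi> P = of_real (ball_norm P)"
    using \<phi> unfolding support_functionals_def by blast+
  have "\<phi> (P + pointwise_scale scl a R) = \<phi> P + a * \<phi> R"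
    using \<phi>'(1) P R Z_scale[OF R, of a] unfolding functionals_on_def by simp
  then have "norm (\<phi> (P + pointwise_scale scl a R)) = ball_norm P"
    using 0 \<phi>'(3) ball_norm_nonneg[OF Z_bounded[OF P]] by simp
  then show "ball_norm P \<le> ball_norm (P + pointwise_scale scl a R)"
    using functional_le[OF \<phi>'(1,2) Z_add[OF P Z_scale[OF R, of a]]] by simp
qed

text \<open>Linearity and the norm bound each concern at most three functions at a time, so they
  pass from evaluations to a cluster point.\<close>

lemma norming_limit_support_functional:
  assumes P: "P \<in> Z" "0 < ball_norm P" and Q: "Q \<in> Z" and l: "l \<in> norming_limits C P Q"
  obtains \<phi> where "\<phi> \<in> support P" "\<phi> Q = l"
proof -
  obtain x c where xc: "\<And>n::nat. x n \<in> cball 0 1" "\<And>n. c n \<in> C"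
    and limP: "(\<lambda>n. blinfun_apply (c n) (P (x n))) \<longlonglongrightarrow> of_real (ball_norm P)"
    and limQ: "(\<lambda>n. blinfun_apply (c n) (Q (x n))) \<longlonglongrightarrow> l"
    using l unfolding norming_limits_def by blast
  define f where "f n R = blinfun_apply (c n) (R (x n))" for n R
  have f_le: "norm (f n R) \<le> ball_norm R" if "R \<in> Z" for n R
    unfolding f_def by (rule norm_C_ball_le[OF Z_bounded[OF that] xc])
  have f_bounded: "bounded (range (\<lambda>n. f n R))" if "R \<in> Z" for R
    unfolding bounded_iff using f_le[OF that] by blast
  obtain g where g: "g \<in> extensional Z" and cluster: "\<And>A. finite A \<Longrightarrow> A \<subseteq> Z \<Longrightarrow>
       \<exists>r. filterlim r sequentially sequentially \<and> (\<forall>R\<in>A. (\<lambda>n. f (r n) R) \<longlonglongrightarrow> g R)"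
    by (rule pointwise_bounded_cluster_point[of Z f, OF f_bounded]) (assumption, rule that)
  \<comment> \<open>Where the evaluations already converge, as at \<open>P\<close> and
    \<open>Q\<close>, the cluster point has no freedom.\<close>
  have lim: "g R = m" if R: "R \<in> Z" and m: "(\<lambda>n. f n R) \<longlonglongrightarrow> m" for R m
  proof -
    obtain r where r: "filterlim r sequentially sequentially" "(\<lambda>n. f (r n) R) \<longlonglongrightarrow> g R"
      using cluster[of "{R}"] R by auto
    show ?thesis
      by (rule LIMSEQ_unique[OF r(2) filterlim_compose[OF m r(1)]])
  qed
  have "g \<in> support P"
  proof (rule supportI[OF g _ _ _ P])
    fix R S assume RS: "R \<in> Z" "S \<in> Z"
    then obtain r where r: "(\<lambda>n. f (r n) R) \<longlonglongrightarrow> g R" "(\<lambda>n. f (r n) S) \<longlonglongrightarrow> g S"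
        "(\<lambda>n. f (r n) (R + S)) \<longlonglongrightarrow> g (R + S)"
      using cluster[of "{R, S, R + S}"] Z_add by auto
    have "(\<lambda>n. f (r n) (R + S)) \<longlonglongrightarrow> g R + g S"
      using tendsto_add[OF r(1,2)] by (simp add: f_def blinfun.add_right)
    then show "g (R + S) = g R + g S"
      using r(3) by (intro LIMSEQ_unique)
  next
    fix a R assume R: "R \<in> Z"
    then obtain r where r: "(\<lambda>n. f (r n) R) \<longlonglongrightarrow> g R"
        "(\<lambda>n. f (r n) (pointwise_scale scl a R)) \<longlonglongrightarrow> g (pointwise_scale scl a R)"
      using cluster[of "{R, pointwise_scale scl a R}"] Z_scale by auto
    have "(\<lambda>n. f (r n) (pointwise_scale scl a R)) \<longlonglongrightarrow> a * g R"
      using tendsto_mult_left[OF r(1), of a] by (simp add: f_def pointwise_scale_def C_scale xc(2))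
    then show "g (pointwise_scale scl a R) = a * g R"
      using r(2) by (intro LIMSEQ_unique)
  next
    fix R assume R: "R \<in> Z"
    then obtain r where r: "(\<lambda>n. f (r n) R) \<longlonglongrightarrow> g R"
      using cluster[of "{R}"] by auto
    show "norm (g R) \<le> ball_norm R"
      using f_le[OF R] by (intro LIMSEQ_le_const2[OF tendsto_norm[OF r]]) blast
  qed (use limP in \<open>simp add: f_def lim[OF P(1)]\<close>)
  moreover have "g Q = l"
    using limQ by (intro lim[OF Q]) (simp add: f_def)
  ultimately show ?thesis by (rule that)
qed

text \<open>If \<open>ball_norm P = 0\<close>, the negative of a support functional is another one.
  Uniqueness would make it zero, against dual norm one.\<close>

lemma support_zero_not_singleton:
  assumes P: "P \<in> Z" "ball_norm P = 0"
  shows "\<not> is_singleton (support P)"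
proof
  assume "is_singleton (support P)"
  then obtain \<phi> where \<phi>: "support P = {\<phi>}" by (rule is_singletonE)
  then have \<phi>': "\<phi> \<in> functionals_on (pointwise_scale scl) Z ball_norm" "functional_norm Z ball_norm \<phi> = 1"
      "\<phi> P = of_real (ball_norm P)"
    unfolding support_functionals_def by blast+
  \<comment> \<open>The restriction keeps the negative extensional.\<close>
  define \<psi> where "\<psi> = (\<lambda>R\<in>Z. - \<phi> R)"
  have "\<psi> \<in> functionals_on (pointwise_scale scl) Z ball_norm"
    using \<phi>'(1) Z_add Z_scale unfolding functionals_on_def by (simp add: \<psi>_def)
  moreover have "functional_norm Z ball_norm \<psi> = functional_norm Z ball_norm \<phi>"
    unfolding functional_norm_def by (rule SUP_cong) (simp_all add: \<psi>_def)
  moreover have "\<psi> P = of_real (ball_norm P)"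
    using \<phi>'(3) P by (simp add: \<psi>_def)
  ultimately have "\<psi> \<in> support P"
    unfolding support_functionals_def using \<phi>'(2) by simp
  then have eq: "\<psi> = \<phi>" using \<phi> by blast
  have "norm (\<phi> R) = 0" if "R \<in> Z" for R
  proof -
    have "\<phi> R = - \<phi> R" using that fun_cong[OF eq, of R] by (simp add: \<psi>_def)
    then have "2 * \<phi> R = 0" by (metis add.right_inverse mult_2)
    then show ?thesis by simp
  qed
  then have "functional_norm Z ball_norm \<phi> = (SUP z\<in>{z \<in> Z. ball_norm z \<le> 1}. 0)"
    unfolding functional_norm_def by (intro SUP_cong) simp_all
  \<comment> \<open>The zero function makes the index set nonempty, so the supremum of the constant
    \<open>0\<close> is \<open>0\<close>.\<close>
  moreover have "ball_norm (\<lambda>_::'x. 0::'y) \<le> 1"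
    by (rule ball_norm_le) simp
  then have "{z \<in> Z. ball_norm z \<le> 1} \<noteq> {}"
    using Z_const[of 0] by blast
  ultimately show False
    using \<phi>'(2) by simp
qed

text \<open>Unique limits depend linearly on \<open>Q\<close>: additivity comes from a norming
  sequence common to \<open>Q\<close> and \<open>R\<close>. The constants in \<open>Z\<close> rule
  out \<open>ball_norm P = 0\<close>.\<close>

lemma singleton_norming_limits_functional:
  assumes P: "P \<in> Z" and single: "\<And>Q. Q \<in> Z \<Longrightarrow> is_singleton (norming_limits C P Q)"
  obtains \<phi> where "0 < ball_norm P" "\<phi> \<in> support P" "\<And>Q. Q \<in> Z \<Longrightarrow> norming_limits C P Q = {\<phi> Q}"
proof -
  define \<phi> where "\<phi> = (\<lambda>Q\<in>Z. the_elem (norming_limits C P Q))"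
  have \<phi>: "norming_limits C P Q = {\<phi> Q}" if "Q \<in> Z" for Q
    using single[OF that] that by (simp add: \<phi>_def is_singleton_the_elem)
  have pos: "0 < ball_norm P"
  proof (rule ccontr)
    assume "\<not> 0 < ball_norm P"
    then have "ball_norm P = 0"
      using ball_norm_nonneg[OF Z_bounded[OF P]] by simp
    then obtain y where "\<not> is_singleton (norming_limits C P (\<lambda>_. y))"
      by (rule norming_limits_const_not_singleton[OF Z_bounded[OF P]])
    then show False using single[OF Z_const] by blast
  qed
  have "\<phi> \<in> support P"
  proof (rule supportI[OF _ _ _ _ P pos])
    show "\<phi> \<in> extensional Z"
      by (simp add: \<phi>_def)
    fix Q assume Q: "Q \<in> Z"
    have l: "\<phi> Q \<in> norming_limits C P Q" using \<phi>[OF Q] by simp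
    show "norm (\<phi> Q) \<le> ball_norm Q"
      by (rule norm_norming_limit_le[OF Z_bounded[OF Q] l])
    show "\<phi> (pointwise_scale scl a Q) = a * \<phi> Q" for a
      using norming_limits_pointwise_scale[OF l, of a] \<phi>[OF Z_scale[OF Q, of a]] by simp
    fix R assume R: "R \<in> Z"
    obtain x c q r where xc: "\<And>n::nat. x n \<in> cball 0 1" "\<And>n. c n \<in> C"
      and lim: "(\<lambda>n. blinfun_apply (c n) (P (x n))) \<longlonglongrightarrow> of_real (ball_norm P)"
      "(\<lambda>n. blinfun_apply (c n) (Q (x n))) \<longlonglongrightarrow> q" "(\<lambda>n. blinfun_apply (c n) (R (x n))) \<longlonglongrightarrow> r"
      and qr: "q \<in> norming_limits C P Q" "r \<in> norming_limits C P R"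
      by (rule ex_common_norming_sequence[OF Z_bounded[OF P] Z_bounded[OF Q] Z_bounded[OF R]]) blast
    have "(\<lambda>n. blinfun_apply (c n) ((Q + R) (x n))) \<longlonglongrightarrow> q + r"
      using tendsto_add[OF lim(2,3)] by (simp add: blinfun.add_right)
    then have "q + r \<in> norming_limits C P (Q + R)"
      unfolding norming_limits_def using xc lim(1) by blast
    then show "\<phi> (Q + R) = \<phi> Q + \<phi> R"
      using qr \<phi>[OF Q] \<phi>[OF R] \<phi>[OF Z_add[OF Q R]] by simp
  next
    show "\<phi> P = of_real (ball_norm P)"
      using norming_limits_self[of "\<phi> P" P] \<phi>[OF P] by simp
  qed
  then show ?thesis using that pos \<phi> by blast
qed

theorem smooth_point_iff:
  assumes P: "P \<in> Z"
  shows "smooth_point (pointwise_scale scl) Z ball_norm P \<longleftrightarrow>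
    (\<forall>Q\<in>Z. is_singleton (norming_limits C P Q))"
proof -
  have "smooth_point (pointwise_scale scl) Z ball_norm P \<longleftrightarrow> is_singleton (support P)"
    unfolding smooth_point_def support_functionals_def ..
  also have "\<dots> \<longleftrightarrow> (\<forall>Q\<in>Z. is_singleton (norming_limits C P Q))"
  proof
    assume single: "is_singleton (support P)"
    then have pos: "0 < ball_norm P"
      using support_zero_not_singleton[OF P] ball_norm_nonneg[OF Z_bounded[OF P]] by fastforce
    obtain \<phi> where \<phi>: "support P = {\<phi>}"
      using single by (rule is_singletonE)
    show "\<forall>Q\<in>Z. is_singleton (norming_limits C P Q)"
    proof
      fix Q assume Q: "Q \<in> Z"
      have "l = \<phi> Q" if l: "l \<in> norming_limits C P Q" for l
        by (rule norming_limit_support_functional[OF P pos Q l]) (use \<phi> in auto)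
      then have "norming_limits C P Q = {\<phi> Q}"
        using norming_limits_nonempty[OF Z_bounded[OF P] Z_bounded[OF Q]] by blast
      then show "is_singleton (norming_limits C P Q)"
        by simp
    qed
  next
    assume "\<forall>Q\<in>Z. is_singleton (norming_limits C P Q)"
    then obtain \<phi> where pos: "0 < ball_norm P" and \<phi>: "\<phi> \<in> support P" "\<And>Q. Q \<in> Z \<Longrightarrow> norming_limits C P Q = {\<phi> Q}"
      using singleton_norming_limits_functional[OF P] by blast
    have "\<psi> = \<phi>" if \<psi>: "\<psi> \<in> support P" for \<psi>
    proof (rule extensionalityI[of _ Z])
      show "\<psi> \<in> extensional Z" "\<phi> \<in> extensional Z"
        using \<phi>(1) \<psi> unfolding support_functionals_def functionals_on_def by blast+
      fix Q assume Q: "Q \<in> Z"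
      have lin: "\<theta> (Q + pointwise_scale scl a P) = \<theta> Q + a * of_real (ball_norm P)"
        if "\<theta> \<in> support P" for \<theta> a
        using that Q P Z_scale[OF P, of a] unfolding support_functionals_def functionals_on_def by simp
      \<comment> \<open>The multiple of \<open>P\<close> is chosen to cancel \<psi> at
        \<open>Q\<close>, as \<psi> takes the value \<open>ball_norm P\<close> at
        \<open>P\<close>.\<close>
      define R where "R = Q + pointwise_scale scl (- \<psi> Q / of_real (ball_norm P)) P"
      have R: "R \<in> Z"
        unfolding R_def by (intro Z_add Q Z_scale P)
      have "\<psi> R = 0"
        unfolding R_def lin[OF \<psi>] using pos by simp
      then have "0 \<in> convex hull (norming_limits C P R)"
        by (intro convex_hull_if_birkhoff_orthogonal[OF Z_bounded[OF P] Z_bounded[OF R]]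
            birkhoff_orthogonal_kernel[OF \<psi> P R])
      \<comment> \<open>The set of limits at \<open>R\<close> is a single point, so its hull
        contains nothing else.\<close>
      then have "\<phi> R = 0"
        unfolding \<phi>(2)[OF R] by simp
      then show "\<psi> Q = \<phi> Q"
        unfolding R_def lin[OF \<phi>(1)] using pos by simp
    qed
    then have "support P = {\<phi>}"
      using \<phi>(1) by blast
    then show "is_singleton (support P)"
      by simp
  qed
  finally show ?thesis .
qed

end

theorem proposition3p16:
  fixes scaleX :: "'k::real_or_complex \<Rightarrow> 'x::banach \<Rightarrow> 'x"
    and scaleY :: "'k \<Rightarrow> 'y::banach \<Rightarrow> 'y"
    and C :: "('y \<Rightarrow>\<^sub>L 'k) set"
  assumes "banach_over scaleX" and "banach_over scaleY"
    and "C \<subseteq> dual scaleY \<inter> sphere 0 1"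
    and "dual scaleY \<inter> cball 0 1 = weak_star_topology scaleY closure_of (convex hull C)"
  shows "(\<forall>P\<in>polynomials scaleX scaleY. \<forall>Q\<in>polynomials scaleX scaleY.
            birkhoff_orthogonal (pointwise_scale scaleY) ball_norm P Q \<longleftrightarrow>
            0 \<in> convex hull (norming_limits C P Q)) \<and>
         (\<forall>P\<in>polynomials scaleX scaleY.
            smooth_point (pointwise_scale scaleY) (polynomials scaleX scaleY) ball_norm P \<longleftrightarrow>
            (\<forall>Q\<in>polynomials scaleX scaleY. is_singleton (norming_limits C P Q)))"
proof -
  interpret banach_over scaleY by fact
  interpret norming_set scaleY C
    using assms(3,4) by unfold_locales
  interpret bounded_function_space scaleY C "polynomials scaleX scaleY"
    by unfold_locales (fact bounded_polynomial[OF assms(1,2)] polynomials_add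
        polynomials_pointwise_scale[OF assms(2)] polynomials_const)+
  show ?thesis
  proof (intro conjI ballI)
    fix P Q assume "P \<in> polynomials scaleX scaleY" "Q \<in> polynomials scaleX scaleY"
    then have P: "bounded (P ` cball 0 1)" and Q: "bounded (Q ` cball 0 1)"
      by (simp_all only: Z_bounded)
    show "birkhoff_orthogonal (pointwise_scale scaleY) ball_norm P Q \<longleftrightarrow>
        0 \<in> convex hull (norming_limits C P Q)"
      using convex_hull_if_birkhoff_orthogonal[OF P Q] birkhoff_orthogonal_if_convex_hull[OF P Q] ..
  qed (rule smooth_point_iff)
qed

end
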